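(* Let $\Bbbk$ be a field of characteristic $0$ and let $(A,\circ,\ast)$ be a finite-dimensional dual pre-Poisson (DPP) algebra over $\Bbbk$. (1) Let $r\in A\otimes A$ be such that $(A,\circ,\ast,\nu_r,\vartheta_r)$ is a factorizable DPP bialgebra, with $\mathcal I=r^\sharp-\tau(r)^\sharp:A^*\to A$. Then $(A,\circ,\ast,\omega_{\mathcal I},R)$ is a quadratic Rota-Baxter DPP algebra of weight $\lambda$, where the linear map $R:A\to A$ and the bilinear form $\omega_{\mathcal I}$ on $A$ are defined by $$R:=\lambda\,\tau(r)^\sharp\,\mathcal I^{-1},\qquad \omega_{\mathcal I}(a_1,a_2):=\langle \mathcal I^{-1}(a_1),a_2\rangle\quad (a_1,a_2\in A).$$ (2) Conversely, let $(A,\circ,\ast,\omega,R)$ be a quadratic Rota-Baxter DPP algebra of weight $\lambda$, and let $J_\omega:A^*\to A$ be the linear isomorphism determined by $\langle J_\omega^{-1}(a_1),a_2\rangle=\omega(a_1,a_2)$ for all $a_1,a_2\in A$. If $\lambda\neq 0$, define $$r^\sharp:=\tfrac1\lambda(R+\lambda\,\mathrm{id})J_\omega:A^*\to A$$ and define $r\in A\otimes A$ by $\langle r,\xi\otimes\eta\rangle=\langle r^\sharp(\xi),\eta\rangle$ for $\xi,\eta\in A^*$. Then $r$ is a solution of the DPYBE in $(A,\circ,\ast)$ and $(A,\circ,\ast,\nu_r,\vartheta_r)$ is a factorizable DPP bialgebra.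
   Context: All vector spaces are finite-dimensional over a field $\Bbbk$ of characteristic $0$; $\langle-,-\rangle$ is the natural pairing between a space and its dual; $\tau(x\otimes y)=y\otimes x$. **DPP algebras.** A perm algebra $(A,\circ)$ is a vector space with a bilinear product such that $a_1\circ(a_2\circ a_3)=(a_1\circ a_2)\circ a_3=(a_2\circ a_1)\circ a_3$. A (left) Leibniz algebra $(A,\ast)$ satisfies $a_1\ast(a_2\ast a_3)=(a_1\ast a_2)\ast a_3+a_2\ast(a_1\ast a_3)$. A DPP algebra $(A,\circ,\ast)$ is a perm algebra $(A,\circ)$ and a Leibniz algebra $(A,\ast)$ with $(a_1\circ a_2)\ast a_3=a_1\circ(a_2\ast a_3)+a_2\circ(a_1\ast a_3)$ and $(a_1\ast a_2)\circ a_3=a_1\ast(a_2\circ a_3)-a_2\circ(a_1\ast a_3)=-(a_2\ast a_1)\circ a_3$. Write $L(a)b=a\circ b$, $R_\circ(a)b=b\circ a$, $\tilde L(a)b=a\ast b$, $\tilde R(a)b=b\ast a$. **DPP coalgebras.** $(A,\nu,\vartheta)$ with $\nu,\vartheta:A\to A\otimes A$ is a DPP coalgebra if $(\nu\otimes\mathrm{id})\nu=(\mathrm{id}\otimes\nu)\nu=(\tau\otimes\mathrm{id})(\mathrm{id}\otimes\nu)\nu$ (perm coalgebra), $(\mathrm{id}\otimes\vartheta)\vartheta=(\vartheta\otimes\mathrm{id})\vartheta+(\tau\otimes\mathrm{id})(\mathrm{id}\otimes\vartheta)\vartheta$ (Leibniz coalgebra), and $(\mathrm{id}\otimes\nu)\vartheta=(\vartheta\otimes\mathrm{id})\nu+(\tau\otimes\mathrm{id})(\mathrm{id}\otimes\vartheta)\nu$,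 $(\nu\otimes\mathrm{id})\vartheta=(\mathrm{id}\otimes\vartheta)\nu+(\tau\otimes\mathrm{id})(\mathrm{id}\otimes\vartheta)\nu$, $(\vartheta\otimes\mathrm{id})\nu=-(\tau\otimes\mathrm{id})(\vartheta\otimes\mathrm{id})\nu$. **DPP bialgebras.** $(A,\circ,\ast,\nu,\vartheta)$ is a DPP bialgebra if $(A,\circ,\ast)$ is a DPP algebra, $(A,\nu,\vartheta)$ is a DPP coalgebra, and for all $a_1,a_2\in A$ the following hold. Perm bialgebra conditions: $(R_\circ(a_1)\otimes\mathrm{id})\nu(a_2)=\tau((R_\circ(a_2)\otimes\mathrm{id})\nu(a_1))$; $\nu(a_1\circ a_2)=((L-R_\circ)(a_1)\otimes\mathrm{id})\nu(a_2)+(\mathrm{id}\otimes R_\circ(a_2))\nu(a_1)$; $\nu(a_1\circ a_2)=(\mathrm{id}\otimes L(a_1))\nu(a_2)+((L-R_\circ)(a_2)\otimes\mathrm{id})(\nu(a_1)-\tau\nu(a_1))$. Leibniz bialgebra conditions: $\tau((\tilde R(a_2)\otimes\mathrm{id})\vartheta(a_1))=(\tilde R(a_1)\otimes\mathrm{id})\vartheta(a_2)$; $\vartheta(a_1\ast a_2)=(\mathrm{id}\otimes\tilde R(a_2)-(\tilde L+\tilde R)(a_2)\otimes\mathrm{id})(\vartheta(a_1)+\tau\vartheta(a_1))+(\mathrm{id}\otimes\tilde L(a_1)+\tilde L(a_1)\otimes\mathrm{id})\vartheta(a_2)$. Mixed conditions (with $\nu^-:=\nu-\tau\nu$, $\vartheta^+:=\vartheta+\tau\vartheta$):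 1. $\nu(a_1\ast a_2)=(\mathrm{id}\otimes\tilde L(a_1)+\tilde L(a_1)\otimes\mathrm{id})\nu(a_2)+((L-R_\circ)(a_2)\otimes\mathrm{id}-\mathrm{id}\otimes R_\circ(a_2))\vartheta^+(a_1)$; 2. $\vartheta(a_1\circ a_2)=(\mathrm{id}\otimes L(a_1))\vartheta(a_2)+(\mathrm{id}\otimes R_\circ(a_2))\vartheta(a_1)-((\tilde L+\tilde R)(a_1)\otimes\mathrm{id})\nu(a_2)-((\tilde L+\tilde R)(a_2)\otimes\mathrm{id})\nu^-(a_1)$; 3. $(\mathrm{id}\otimes\tilde R(a_1))\tau\nu(a_2)=-(R_\circ(a_2)\otimes\mathrm{id})\vartheta(a_1)$; 4. $\nu(a_1\ast a_2)=(\mathrm{id}\otimes L(a_1)-L(a_1)\otimes\mathrm{id})\vartheta(a_2)+(\mathrm{id}\otimes\tilde R(a_2)-(\tilde L+\tilde R)(a_2)\otimes\mathrm{id})\nu^-(a_1)$; 5. $\vartheta^+(a_1\circ a_2)=(\mathrm{id}\otimes L(a_1))\vartheta^+(a_2)+(\mathrm{id}\otimes L(a_2))\vartheta^+(a_1)-(\tilde L(a_1)\otimes\mathrm{id})\nu^-(a_2)-(\tilde L(a_2)\otimes\mathrm{id})\nu^-(a_1)$; 6. $\vartheta(a_1\circ a_2)=(L(a_1)\otimes\mathrm{id})\vartheta(a_2)-(\mathrm{id}\otimes\tilde R(a_2))\nu^-(a_1)+(\mathrm{id}\otimes\tilde L(a_1))\nu(a_2)+((L-R_\circ)(a_2)\otimes\mathrm{id})\vartheta^+(a_1)$;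 7. $\nu(a_1\ast a_2+a_2\ast a_1)=(\mathrm{id}\otimes(\tilde L+\tilde R)(a_1))\nu(a_2)+((\tilde L+\tilde R)(a_1)\otimes\mathrm{id})\tau\nu(a_2)+(\mathrm{id}\otimes(L-R_\circ)(a_2))\vartheta(a_1)+((L-R_\circ)(a_2)\otimes\mathrm{id})\tau\vartheta(a_1)$. **DPYBE, quasi-triangular, factorizable.** For $a\in A$ put $F(a)=(\tilde L+\tilde R)(a)\otimes\mathrm{id}-\mathrm{id}\otimes\tilde R(a)$ and $G(a)=\mathrm{id}\otimes R_\circ(a)+(R_\circ-L)(a)\otimes\mathrm{id}$ on $A\otimes A$. For $r\in A\otimes A$ set $\nu_r(a)=G(a)(r)$, $\vartheta_r(a)=F(a)(r)$; $r$ is DP-invariant if $F(a)(r)=G(a)(r)=0$ for all $a$. For $r=\sum_i x_i\otimes y_i$, the DPYBE is the pair of equations in $A^{\otimes3}$: $\mathbf P_r=\sum_{i,j}\big(x_i\otimes(y_i\circ x_j)\otimes y_j-x_i\otimes x_j\otimes(y_i\circ y_j)+(x_i\circ x_j)\otimes y_i\otimes y_j-(x_i\circ x_j)\otimes y_j\otimes y_i\big)=0$, $\mathbf L_r=\sum_{i,j}\big((x_i\ast x_j)\otimes y_i\otimes y_j-x_i\otimes(y_i\ast x_j)\otimes y_j-x_j\otimes(x_i\ast y_j)\otimes y_i+x_j\otimes x_i\otimes(y_i\ast y_j)\big)=0$. A quasi-triangular DPP bialgebra associated with $r$ is a DPP bialgebra of the form $(A,\circ,\ast,\nu_r,\vartheta_r)$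 with $r$ a solution of the DPYBE and $r-\tau(r)$ DP-invariant. For $s\in A\otimes A$, $s^\sharp:A^*\to A$ is given by $\langle s^\sharp(\xi_1),\xi_2\rangle=\langle\xi_1\otimes\xi_2,s\rangle$. It is factorizable if moreover $\mathcal I=r^\sharp-\tau(r)^\sharp$ is a linear isomorphism. **Quadratic Rota-Baxter DPP algebras.** A quadratic DPP algebra $(A,\circ,\ast,\omega)$ is a DPP algebra with a nondegenerate skew-symmetric bilinear form $\omega$ with $\omega(a_1\circ a_2,a_3)=\omega(a_1,a_2\circ a_3-a_3\circ a_2)$ and $\omega(a_1\ast a_2,a_3)=\omega(a_1,a_2\ast a_3+a_3\ast a_2)$. A Rota-Baxter operator of weight $\lambda\in\Bbbk$ on $(A,\circ,\ast)$ is a linear map $R:A\to A$ with $R(a_1)\cdot R(a_2)=R(R(a_1)\cdot a_2+a_1\cdot R(a_2)+\lambda a_1\cdot a_2)$ for both $\cdot=\circ$ and $\cdot=\ast$. $(A,\circ,\ast,\omega,R)$ is a quadratic Rota-Baxter DPP algebra of weight $\lambda$ if $(A,\circ,\ast,\omega)$ is quadratic, $R$ is a Rota-Baxter operator of weight $\lambda$, and $\omega(a_1,R(a_2))+\omega(R(a_1),a_2)+\lambda\omega(a_1,a_2)=0$ for all $a_1,a_2\in A$. *)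

theory Defs
  imports Complex_Main "HOL-Library.Function_Algebras"
begin

section \<open>Dual space and tensor powers\<close>

text \<open>
  A tensor in \<open>A \<otimes> A\<close> is represented by the bilinear form on \<open>A\<^sup>*\<close> it induces by evaluation, and
  \<open>A \<otimes> A\<close> is the span of the pure tensors; similarly for three factors. The forms are set to \<open>0\<close>
  outside \<open>A\<^sup>*\<close>, so that equality of tensors is equality of functions. Under this representation
  \<open>\<langle>\<xi> \<otimes> \<eta>, t\<rangle>\<close> is \<open>t \<xi> \<eta>\<close>. The lemmas of this section show that the construction has the
  universal property of the tensor product and that the operations act as expected on pure tensors.
  Addition of functionals and tensors is the pointwise one of \<open>Function_Algebras\<close>.
\<close>

type_synonym ('a, 'k) tensor2 = "('a \<Rightarrow> 'k) \<Rightarrow> ('a \<Rightarrow> 'k) \<Rightarrow> 'k"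
type_synonym ('a, 'k) tensor3 = "('a \<Rightarrow> 'k) \<Rightarrow> ('a \<Rightarrow> 'k) \<Rightarrow> ('a \<Rightarrow> 'k) \<Rightarrow> 'k"

locale tensor_space = vector_space scale
  for scale :: "'k::field_char_0 \<Rightarrow> 'a::ab_group_add \<Rightarrow> 'a"
begin

definition dual :: "('a \<Rightarrow> 'k) set" where
  "dual = {\<xi>. Vector_Spaces.linear scale (*) \<xi>}"

definition pure2 :: "'a \<Rightarrow> 'a \<Rightarrow> ('a, 'k) tensor2" where
  "pure2 x y = (\<lambda>\<xi> \<eta>. if \<xi> \<in> dual \<and> \<eta> \<in> dual then \<xi> x * \<eta> y else 0)"

definition pure3 :: "'a \<Rightarrow> 'a \<Rightarrow> 'a \<Rightarrow> ('a, 'k) tensor3" where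
  "pure3 x y z = (\<lambda>\<xi> \<eta> \<zeta>. if \<xi> \<in> dual \<and> \<eta> \<in> dual \<and> \<zeta> \<in> dual then \<xi> x * \<eta> y * \<zeta> z else 0)"

definition scale2 :: "'k \<Rightarrow> ('a, 'k) tensor2 \<Rightarrow> ('a, 'k) tensor2" where
  "scale2 c t = (\<lambda>\<xi> \<eta>. c * t \<xi> \<eta>)"

definition tensors2 :: "('a, 'k) tensor2 set" where
  "tensors2 = module.span scale2 {pure2 x y |x y. True}"

text \<open>\<open>f \<otimes> g\<close> for linear maps \<open>f\<close>, \<open>g\<close> on \<open>A\<close>; \<open>\<tau>\<close>; \<open>\<tau> \<otimes> id\<close>; and \<open>d \<otimes> id\<close>, \<open>id \<otimes> d\<close> for
  linear \<open>d : A \<rightarrow> A \<otimes> A\<close>.\<close>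

definition map2 :: "('a \<Rightarrow> 'a) \<Rightarrow> ('a \<Rightarrow> 'a) \<Rightarrow> ('a, 'k) tensor2 \<Rightarrow> ('a, 'k) tensor2" where
  "map2 f g t = (\<lambda>\<xi> \<eta>. if \<xi> \<in> dual \<and> \<eta> \<in> dual then t (\<xi> \<circ> f) (\<eta> \<circ> g) else 0)"

definition flip2 :: "('a, 'k) tensor2 \<Rightarrow> ('a, 'k) tensor2" where
  "flip2 t = (\<lambda>\<xi> \<eta>. t \<eta> \<xi>)"

definition flip12 :: "('a, 'k) tensor3 \<Rightarrow> ('a, 'k) tensor3" where
  "flip12 t = (\<lambda>\<xi> \<eta> \<zeta>. t \<eta> \<xi> \<zeta>)"

definition comult_id :: "('a \<Rightarrow> ('a, 'k) tensor2) \<Rightarrow> ('a, 'k) tensor2 \<Rightarrow> ('a, 'k) tensor3" where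
  "comult_id d t = (\<lambda>\<xi> \<eta> \<zeta>. if \<xi> \<in> dual \<and> \<eta> \<in> dual \<and> \<zeta> \<in> dual then t (\<lambda>a. d a \<xi> \<eta>) \<zeta> else 0)"

definition id_comult :: "('a \<Rightarrow> ('a, 'k) tensor2) \<Rightarrow> ('a, 'k) tensor2 \<Rightarrow> ('a, 'k) tensor3" where
  "id_comult d t = (\<lambda>\<xi> \<eta> \<zeta>. if \<xi> \<in> dual \<and> \<eta> \<in> dual \<and> \<zeta> \<in> dual then t \<xi> (\<lambda>a. d a \<eta> \<zeta>) else 0)"

definition sharp :: "('a, 'k) tensor2 \<Rightarrow> ('a \<Rightarrow> 'k) \<Rightarrow> 'a" where
  "sharp s \<xi> = (THE a. \<forall>\<eta>\<in>dual. \<eta> a = s \<xi> \<eta>)"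

text \<open>The tensor \<open>r\<close> with \<open>\<langle>r, \<xi> \<otimes> \<eta>\<rangle> = \<langle>S(\<xi>), \<eta>\<rangle>\<close>.\<close>

definition tensor_of :: "(('a \<Rightarrow> 'k) \<Rightarrow> 'a) \<Rightarrow> ('a, 'k) tensor2" where
  "tensor_of S = (\<lambda>\<xi> \<eta>. if \<xi> \<in> dual \<and> \<eta> \<in> dual then \<eta> (S \<xi>) else 0)"

definition dual_iso :: "(('a \<Rightarrow> 'k) \<Rightarrow> 'a) \<Rightarrow> bool" where
  "dual_iso T \<longleftrightarrow> bij_betw T dual UNIV \<and>
     (\<forall>\<xi>\<in>dual. \<forall>\<eta>\<in>dual. T (\<xi> + \<eta>) = T \<xi> + T \<eta>) \<and>
     (\<forall>c. \<forall>\<xi>\<in>dual. T (\<lambda>a. c * \<xi> a) = scale c (T \<xi>))"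

definition bilinear_op :: "('a \<Rightarrow> 'a \<Rightarrow> 'a) \<Rightarrow> bool" where
  "bilinear_op m \<longleftrightarrow> (\<forall>a. Vector_Spaces.linear scale scale (m a)) \<and>
     (\<forall>b. Vector_Spaces.linear scale scale (\<lambda>a. m a b))"

definition bilinear_form :: "('a \<Rightarrow> 'a \<Rightarrow> 'k) \<Rightarrow> bool" where
  "bilinear_form w \<longleftrightarrow> (\<forall>a. Vector_Spaces.linear scale (*) (w a)) \<and>
     (\<forall>b. Vector_Spaces.linear scale (*) (\<lambda>a. w a b))"

subsection \<open>Adequacy of the representation\<close>

lemma dual_iff: "\<xi> \<in> dual \<longleftrightarrow> (\<forall>x y. \<xi> (x + y) = \<xi> x + \<xi> y) \<and> (\<forall>c x. \<xi> (scale c x) = c * \<xi> x)"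
proof -
  have "vector_space ((*) :: 'k \<Rightarrow> 'k \<Rightarrow> 'k)"
    by unfold_locales (auto simp: algebra_simps)
  then show ?thesis
    unfolding dual_def by (auto simp: Vector_Spaces.linear_iff vector_space_axioms)
qed

lemma dual_scale: "\<xi> \<in> dual \<Longrightarrow> \<xi> (scale c x) = c * \<xi> x"
  by (simp add: dual_iff)

lemma dual_comp:
  "\<xi> \<in> dual \<Longrightarrow> Vector_Spaces.linear scale scale f \<Longrightarrow> \<xi> \<circ> f \<in> dual"
  by (simp add: dual_iff Vector_Spaces.linear_iff)

lemma dual_sum: "\<xi> \<in> dual \<Longrightarrow> \<xi> (\<Sum>i\<in>I. f i) = (\<Sum>i\<in>I. \<xi> (f i))"
proof (induction I rule: infinite_finite_induct)
  case empty
  then show ?case by (metis add_cancel_left_left dual_iff sum.empty)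
next
  case (infinite A)
  then show ?case by (metis add_cancel_left_left dual_iff sum.infinite)
qed (auto simp: dual_iff)

lemma vector_space_scale2: "vector_space scale2"
  by unfold_locales (auto simp: scale2_def fun_eq_iff algebra_simps)

sublocale t2: vector_space scale2
  by (rule vector_space_scale2)

lemma sum_tensor2_apply: "(\<Sum>i\<in>I. t i) \<xi> \<eta> = (\<Sum>i\<in>I. t i \<xi> \<eta>)" for t :: "'i \<Rightarrow> ('a, 'k) tensor2"
  by (induction I rule: infinite_finite_induct) auto

lemma sum_tensor3_apply: "(\<Sum>i\<in>I. t i) \<xi> \<eta> \<zeta> = (\<Sum>i\<in>I. t i \<xi> \<eta> \<zeta>)" for t :: "'i \<Rightarrow> ('a, 'k) tensor3"
  by (induction I rule: infinite_finite_induct) auto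

lemma pure2_in: "pure2 x y \<in> tensors2"
  unfolding tensors2_def by (rule t2.span_base) auto

lemma tensors2_explicit:
  assumes "r \<in> tensors2"
  obtains n :: nat and x y where "r = (\<Sum>i<n. pure2 (x i) (y i))"
proof -
  have "\<exists>(n::nat) x y. r = (\<Sum>i<n. pure2 (x i) (y i))"
    using assms unfolding tensors2_def
  proof (induction rule: t2.span_induct_alt)
    case base
    then show ?case by (intro exI[of _ 0]) auto
  next
    case (step c p t)
    then obtain u v and n :: nat and x y
      where p: "p = pure2 u v" and t: "t = (\<Sum>i<n. pure2 (x i) (y i))" by auto
    have "scale2 c p = pure2 (scale c u) v"
      by (auto simp: p scale2_def pure2_def fun_eq_iff dual_iff)
    then have "scale2 c p + t =
        (\<Sum>i<Suc n. pure2 ((x(n := scale c u)) i) ((y(n := v)) i))"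
      by (simp add: t add.commute)
    then show ?case by blast
  qed
  then show thesis using that by blast
qed

lemma coordinate_dual:
  assumes "independent B" "span B = UNIV"
  shows "(\<lambda>x. representation B x b) \<in> dual"
  using assms by (simp add: dual_iff representation_add representation_scale)

lemma dual_separates:
  assumes "\<And>\<xi>. \<xi> \<in> dual \<Longrightarrow> \<xi> a = \<xi> b"
  shows "a = b"
proof -
  obtain B where B: "independent B" "span B = UNIV"
    using maximal_independent_subset[of UNIV] by (metis top.extremum_uniqueI)
  have "representation B a = representation B b"
    using assms[OF coordinate_dual[OF B]] by auto
  then show ?thesis
    using B by (metis UNIV_I sum_nonzero_representation_eq)
qed

lemma sharp_sum_pure2:
  assumes "\<xi> \<in> dual"
  shows "sharp (\<Sum>i\<in>I. pure2 (x i) (y i)) \<xi> = (\<Sum>i\<in>I. scale (\<xi> (x i)) (y i))"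
  unfolding sharp_def
proof (rule the_equality)
  show *: "\<forall>\<eta>\<in>dual. \<eta> (\<Sum>i\<in>I. scale (\<xi> (x i)) (y i)) = (\<Sum>i\<in>I. pure2 (x i) (y i)) \<xi> \<eta>"
    using assms by (auto simp: sum_tensor2_apply dual_sum pure2_def dual_scale intro!: sum.cong)
  fix a
  assume "\<forall>\<eta>\<in>dual. \<eta> a = (\<Sum>i\<in>I. pure2 (x i) (y i)) \<xi> \<eta>"
  with * show "a = (\<Sum>i\<in>I. scale (\<xi> (x i)) (y i))"
    by (intro dual_separates) auto
qed

lemma map2_pure2:
  assumes "Vector_Spaces.linear scale scale f" "Vector_Spaces.linear scale scale g"
  shows "map2 f g (pure2 x y) = pure2 (f x) (g y)"
  using assms by (auto simp: map2_def pure2_def fun_eq_iff dual_comp)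

lemma flip2_pure2: "flip2 (pure2 x y) = pure2 y x"
  by (auto simp: flip2_def pure2_def fun_eq_iff)

lemma flip12_pure3: "flip12 (pure3 x y z) = pure3 y x z"
  by (auto simp: flip12_def pure3_def fun_eq_iff)

lemma comult_pure2:
  assumes "Vector_Spaces.linear scale scale2 d"
    and "d x = (\<Sum>i\<in>I. pure2 (u i) (v i))"
  shows "comult_id d (pure2 x y) = (\<Sum>i\<in>I. pure3 (u i) (v i) y)"
    and "id_comult d (pure2 y x) = (\<Sum>i\<in>I. pure3 y (u i) (v i))"
proof -
  have d: "(\<lambda>a. d a \<xi> \<eta>) \<in> dual" for \<xi> \<eta>
    using assms(1) by (auto simp: Vector_Spaces.linear_iff dual_iff scale2_def)
  show "comult_id d (pure2 x y) = (\<Sum>i\<in>I. pure3 (u i) (v i) y)"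
    by (auto simp: comult_id_def pure2_def pure3_def fun_eq_iff d assms(2) sum_tensor2_apply
        sum_tensor3_apply sum_distrib_right)
  show "id_comult d (pure2 y x) = (\<Sum>i\<in>I. pure3 y (u i) (v i))"
    by (auto simp: id_comult_def pure2_def pure3_def fun_eq_iff d assms(2) sum_tensor2_apply
        sum_tensor3_apply sum_distrib_left mult.assoc)
qed

theorem tensors2_universal:
  fixes s :: "'k \<Rightarrow> 'c::ab_group_add \<Rightarrow> 'c" and m :: "'a \<Rightarrow> 'a \<Rightarrow> 'c"
  assumes fd: "finite_dimensional_vector_space scale B"
    and s: "vector_space s"
    and m: "\<And>a. Vector_Spaces.linear scale s (m a)" "\<And>b. Vector_Spaces.linear scale s (\<lambda>a. m a b)"
  shows "\<exists>f. Vector_Spaces.linear scale2 s f \<and> (\<forall>x y. f (pure2 x y) = m x y)"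
proof -
  interpret B: finite_dimensional_vector_space scale B by (rule fd)
  interpret s: vector_space s by (rule s)
  interpret p: vector_space_pair scale s ..
  interpret q: vector_space_pair scale2 s ..
  note B = B.finite_Basis B.independent_Basis B.span_Basis
  define \<beta> where "\<beta> b = (\<lambda>x. representation B x b)" for b
  have \<beta>: "\<beta> b \<in> dual" for b
    unfolding \<beta>_def using B by (intro coordinate_dual)
  have expand: "x = (\<Sum>b\<in>B. scale (\<beta> b x) b)" for x
    using B by (simp add: \<beta>_def sum_representation_eq)
  define f where "f t = (\<Sum>b\<in>B. \<Sum>c\<in>B. s (t (\<beta> b) (\<beta> c)) (m b c))" for t
  have "Vector_Spaces.linear scale2 s f"
    by (simp add: Vector_Spaces.linear_iff vector_space_scale2 s f_def scale2_def
        s.scale_left_distrib sum.distrib s.scale_sum_right)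
  moreover have "f (pure2 x y) = m x y" for x y
  proof -
    have "m x y = m (\<Sum>b\<in>B. scale (\<beta> b x) b) y"
      using expand[of x] by (rule arg_cong)
    also have "\<dots> = (\<Sum>b\<in>B. s (\<beta> b x) (m b y))"
      by (simp only: p.linear_sum[OF m(2)] p.linear_scale[OF m(2)])
    also have "\<dots> = (\<Sum>b\<in>B. s (\<beta> b x) (m b (\<Sum>c\<in>B. scale (\<beta> c y) c)))"
      using expand[of y] by (rule arg_cong)
    also have "\<dots> = (\<Sum>b\<in>B. \<Sum>c\<in>B. s (\<beta> b x * \<beta> c y) (m b c))"
      by (simp add: p.linear_sum[OF m(1)] p.linear_scale[OF m(1)] s.scale_sum_right)
    finally show ?thesis
      by (simp add: f_def pure2_def \<beta>)
  qed
  ultimately show ?thesis by blast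
qed

lemma tensors2_ext:
  assumes "Vector_Spaces.linear scale2 s f" "Vector_Spaces.linear scale2 s g"
    and "\<And>x y. f (pure2 x y) = g (pure2 x y)" "t \<in> tensors2"
  shows "f t = g t"
proof -
  interpret g: Vector_Spaces.linear scale2 s g by fact
  interpret q: vector_space_pair scale2 s ..
  show ?thesis
    using assms unfolding tensors2_def by (intro q.linear_eq_on[of f g t]) auto
qed

lemma tensors2_sum_cong:
  fixes s :: "'k \<Rightarrow> 'c::ab_group_add \<Rightarrow> 'c" and m :: "'a \<Rightarrow> 'a \<Rightarrow> 'c"
  assumes "finite_dimensional_vector_space scale B" "vector_space s"
    and "\<And>a. Vector_Spaces.linear scale s (m a)" "\<And>b. Vector_Spaces.linear scale s (\<lambda>a. m a b)"
    and eq: "(\<Sum>i\<in>I. pure2 (x i) (y i)) = (\<Sum>i\<in>I'. pure2 (x' i) (y' i))"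
  shows "(\<Sum>i\<in>I. m (x i) (y i)) = (\<Sum>i\<in>I'. m (x' i) (y' i))"
proof -
  obtain f where f: "Vector_Spaces.linear scale2 s f" "\<And>x y. f (pure2 x y) = m x y"
    using tensors2_universal[OF assms(1-4)] by blast
  interpret s: vector_space s by fact
  interpret q: vector_space_pair scale2 s ..
  show ?thesis
    using arg_cong[OF eq, of f] by (simp add: q.linear_sum[OF f(1)] f(2))
qed

definition scale3 :: "'k \<Rightarrow> ('a, 'k) tensor3 \<Rightarrow> ('a, 'k) tensor3" where
  "scale3 c t = (\<lambda>\<xi> \<eta> \<zeta>. c * t \<xi> \<eta> \<zeta>)"

lemma vector_space_scale3: "vector_space scale3"
  by unfold_locales (auto simp: scale3_def fun_eq_iff algebra_simps)

lemma pure3_linear: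
  "pure3 (x + x') y z = pure3 x y z + pure3 x' y z"
  "pure3 x (y + y') z = pure3 x y z + pure3 x y' z"
  "pure3 x y (z + z') = pure3 x y z + pure3 x y z'"
  "pure3 (scale c x) y z = scale3 c (pure3 x y z)"
  "pure3 x (scale c y) z = scale3 c (pure3 x y z)"
  "pure3 x y (scale c z) = scale3 c (pure3 x y z)"
  by (auto simp: fun_eq_iff pure3_def scale3_def dual_iff distrib_left distrib_right mult_ac)

end

section \<open>The two constructions\<close>

text \<open>\<open>J\<^sub>\<omega>\<close> is the inverse of \<open>a \<mapsto> \<omega>(a, -)\<close>, which as a curried function is \<open>\<omega>\<close> itself.\<close>

definition J_of :: "('a \<Rightarrow> 'a \<Rightarrow> 'k) \<Rightarrow> ('a \<Rightarrow> 'k) \<Rightarrow> 'a" where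
  "J_of \<omega> = the_inv_into UNIV \<omega>"

context tensor_space
begin

definition I_of :: "('a, 'k) tensor2 \<Rightarrow> ('a \<Rightarrow> 'k) \<Rightarrow> 'a" where
  "I_of r \<xi> = sharp r \<xi> - sharp (flip2 r) \<xi>"

definition omega_of :: "('a, 'k) tensor2 \<Rightarrow> 'a \<Rightarrow> 'a \<Rightarrow> 'k" where
  "omega_of r a1 a2 = the_inv_into dual (I_of r) a1 a2"

definition R_of :: "'k \<Rightarrow> ('a, 'k) tensor2 \<Rightarrow> 'a \<Rightarrow> 'a" where
  "R_of lam r a = scale lam (sharp (flip2 r) (the_inv_into dual (I_of r) a))"

text \<open>The tensor \<open>r\<close> with \<open>\<langle>r, \<xi> \<otimes> \<eta>\<rangle> = \<langle>r\<^sup>\<sharp>(\<xi>), \<eta>\<rangle>\<close> for \<open>r\<^sup>\<sharp> = (1/lam) (R + lam id) J\<^sub>\<omega>\<close>.\<close>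

definition r_of :: "'k \<Rightarrow> ('a \<Rightarrow> 'a \<Rightarrow> 'k) \<Rightarrow> ('a \<Rightarrow> 'a) \<Rightarrow> ('a, 'k) tensor2" where
  "r_of lam \<omega> R =
     tensor_of (\<lambda>\<xi>. scale (1 / lam) (R (J_of \<omega> \<xi>) + scale lam (J_of \<omega> \<xi>)))"

end

section \<open>DPP algebras, coalgebras and bialgebras\<close>

locale DPP_algebra = tensor_space scale
  for scale :: "'k::field_char_0 \<Rightarrow> 'a::ab_group_add \<Rightarrow> 'a" +
  fixes circ :: "'a \<Rightarrow> 'a \<Rightarrow> 'a" (infixl \<open>\<odot>\<close> 70)
    and ast :: "'a \<Rightarrow> 'a \<Rightarrow> 'a" (infixl \<open>\<star>\<close> 70)
  assumes circ_bilinear: "bilinear_op circ"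
    and ast_bilinear: "bilinear_op ast"
    and perm_assoc: "a1 \<odot> (a2 \<odot> a3) = (a1 \<odot> a2) \<odot> a3"
    and perm_comm: "(a1 \<odot> a2) \<odot> a3 = (a2 \<odot> a1) \<odot> a3"
    and leibniz: "a1 \<star> (a2 \<star> a3) = (a1 \<star> a2) \<star> a3 + a2 \<star> (a1 \<star> a3)"
    and circ_ast: "(a1 \<odot> a2) \<star> a3 = a1 \<odot> (a2 \<star> a3) + a2 \<odot> (a1 \<star> a3)"
    and ast_circ: "(a1 \<star> a2) \<odot> a3 = a1 \<star> (a2 \<odot> a3) - a2 \<odot> (a1 \<star> a3)"
    and ast_circ_skew: "(a1 \<star> a2) \<odot> a3 = - ((a2 \<star> a1) \<odot> a3)"
begin

text \<open>\<open>L\<close>, \<open>Rc\<close> are the left and right multiplications of \<open>\<odot>\<close>; \<open>Lt\<close>, \<open>Rt\<close> are those of \<open>\<star>\<close>.\<close>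

abbreviation (input) L :: "'a \<Rightarrow> 'a \<Rightarrow> 'a" where "L a \<equiv> (\<lambda>b. a \<odot> b)"
abbreviation (input) Rc :: "'a \<Rightarrow> 'a \<Rightarrow> 'a" where "Rc a \<equiv> (\<lambda>b. b \<odot> a)"
abbreviation (input) Lt :: "'a \<Rightarrow> 'a \<Rightarrow> 'a" where "Lt a \<equiv> (\<lambda>b. a \<star> b)"
abbreviation (input) Rt :: "'a \<Rightarrow> 'a \<Rightarrow> 'a" where "Rt a \<equiv> (\<lambda>b. b \<star> a)"

end

locale DPP_coalgebra = tensor_space scale
  for scale :: "'k::field_char_0 \<Rightarrow> 'a::ab_group_add \<Rightarrow> 'a" +
  fixes \<nu> \<theta> :: "'a \<Rightarrow> ('a, 'k) tensor2"
  assumes nu_linear: "Vector_Spaces.linear scale scale2 \<nu>"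
    and nu_tensors: "\<nu> a \<in> tensors2"
    and theta_linear: "Vector_Spaces.linear scale scale2 \<theta>"
    and theta_tensors: "\<theta> a \<in> tensors2"
    and perm_coassoc: "comult_id \<nu> (\<nu> a) = id_comult \<nu> (\<nu> a)"
    and perm_cocomm: "id_comult \<nu> (\<nu> a) = flip12 (id_comult \<nu> (\<nu> a))"
    and coleibniz: "id_comult \<theta> (\<theta> a) = comult_id \<theta> (\<theta> a) + flip12 (id_comult \<theta> (\<theta> a))"
    and co_circ_ast: "id_comult \<nu> (\<theta> a) = comult_id \<theta> (\<nu> a) + flip12 (id_comult \<theta> (\<nu> a))"
    and co_ast_circ: "comult_id \<nu> (\<theta> a) = id_comult \<theta> (\<nu> a) + flip12 (id_comult \<theta> (\<nu> a))"
    and co_skew: "comult_id \<theta> (\<nu> a) = - flip12 (comult_id \<theta> (\<nu> a))"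
begin

abbreviation nu_minus :: "'a \<Rightarrow> ('a, 'k) tensor2" (\<open>\<nu>\<^sup>-\<close>)
  where "\<nu>\<^sup>- a \<equiv> \<nu> a - flip2 (\<nu> a)"
abbreviation theta_plus :: "'a \<Rightarrow> ('a, 'k) tensor2" (\<open>\<theta>\<^sup>+\<close>)
  where "\<theta>\<^sup>+ a \<equiv> \<theta> a + flip2 (\<theta> a)"

end

locale DPP_bialgebra = DPP_algebra scale circ ast + DPP_coalgebra scale \<nu> \<theta>
  for scale :: "'k::field_char_0 \<Rightarrow> 'a::ab_group_add \<Rightarrow> 'a"
    and circ :: "'a \<Rightarrow> 'a \<Rightarrow> 'a" (infixl \<open>\<odot>\<close> 70)
    and ast :: "'a \<Rightarrow> 'a \<Rightarrow> 'a" (infixl \<open>\<star>\<close> 70)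
    and \<nu> \<theta> :: "'a \<Rightarrow> ('a, 'k) tensor2" +
  assumes perm1: "map2 (Rc a1) id (\<nu> a2) = flip2 (map2 (Rc a2) id (\<nu> a1))"
    and perm2: "\<nu> (a1 \<odot> a2) = map2 (L a1 - Rc a1) id (\<nu> a2) + map2 id (Rc a2) (\<nu> a1)"
    and perm3: "\<nu> (a1 \<odot> a2) =
      map2 id (L a1) (\<nu> a2) + map2 (L a2 - Rc a2) id (\<nu> a1 - flip2 (\<nu> a1))"
    and leibniz1: "flip2 (map2 (Rt a2) id (\<theta> a1)) = map2 (Rt a1) id (\<theta> a2)"
    and leibniz2: "\<theta> (a1 \<star> a2) =
      (map2 id (Rt a2) (\<theta> a1 + flip2 (\<theta> a1)) - map2 (Lt a2 + Rt a2) id (\<theta> a1 + flip2 (\<theta> a1)))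
      + (map2 id (Lt a1) (\<theta> a2) + map2 (Lt a1) id (\<theta> a2))"
    and mixed1: "\<nu> (a1 \<star> a2) =
      (map2 id (Lt a1) (\<nu> a2) + map2 (Lt a1) id (\<nu> a2))
      + (map2 (L a2 - Rc a2) id (\<theta>\<^sup>+ a1) - map2 id (Rc a2) (\<theta>\<^sup>+ a1))"
    and mixed2: "\<theta> (a1 \<odot> a2) =
      map2 id (L a1) (\<theta> a2) + map2 id (Rc a2) (\<theta> a1)
      - map2 (Lt a1 + Rt a1) id (\<nu> a2) - map2 (Lt a2 + Rt a2) id (\<nu>\<^sup>- a1)"
    and mixed3: "map2 id (Rt a1) (flip2 (\<nu> a2)) = - map2 (Rc a2) id (\<theta> a1)"
    and mixed4: "\<nu> (a1 \<star> a2) =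
      (map2 id (L a1) (\<theta> a2) - map2 (L a1) id (\<theta> a2))
      + (map2 id (Rt a2) (\<nu>\<^sup>- a1) - map2 (Lt a2 + Rt a2) id (\<nu>\<^sup>- a1))"
    and mixed5: "\<theta>\<^sup>+ (a1 \<odot> a2) =
      map2 id (L a1) (\<theta>\<^sup>+ a2) + map2 id (L a2) (\<theta>\<^sup>+ a1)
      - map2 (Lt a1) id (\<nu>\<^sup>- a2) - map2 (Lt a2) id (\<nu>\<^sup>- a1)"
    and mixed6: "\<theta> (a1 \<odot> a2) =
      map2 (L a1) id (\<theta> a2) - map2 id (Rt a2) (\<nu>\<^sup>- a1)
      + map2 id (Lt a1) (\<nu> a2) + map2 (L a2 - Rc a2) id (\<theta>\<^sup>+ a1)"
    and mixed7: "\<nu> (a1 \<star> a2 + a2 \<star> a1) =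
      map2 id (Lt a1 + Rt a1) (\<nu> a2) + map2 (Lt a1 + Rt a1) id (flip2 (\<nu> a2))
      + map2 id (L a2 - Rc a2) (\<theta> a1) + map2 (L a2 - Rc a2) id (flip2 (\<theta> a1))"

section \<open>The DPYBE, quasi-triangular and factorizable DPP bialgebras\<close>

context DPP_algebra
begin

definition F :: "'a \<Rightarrow> ('a, 'k) tensor2 \<Rightarrow> ('a, 'k) tensor2" where
  "F a t = map2 (Lt a + Rt a) id t - map2 id (Rt a) t"

definition G :: "'a \<Rightarrow> ('a, 'k) tensor2 \<Rightarrow> ('a, 'k) tensor2" where
  "G a t = map2 id (Rc a) t + map2 (Rc a - L a) id t"

definition nu_of :: "('a, 'k) tensor2 \<Rightarrow> 'a \<Rightarrow> ('a, 'k) tensor2" where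
  "nu_of r a = G a r"

definition theta_of :: "('a, 'k) tensor2 \<Rightarrow> 'a \<Rightarrow> ('a, 'k) tensor2" where
  "theta_of r a = F a r"

definition DP_invariant :: "('a, 'k) tensor2 \<Rightarrow> bool" where
  "DP_invariant r \<longleftrightarrow> (\<forall>a. F a r = 0 \<and> G a r = 0)"

text \<open>The elements \<open>P\<^sub>r\<close> and \<open>L\<^sub>r\<close> computed from a presentation \<open>r = \<Sum>\<^sub>i x\<^sub>i \<otimes> y\<^sub>i\<close>. They do not
  depend on the presentation, see \<open>DPYBE_iff\<close> below.\<close>

definition P_elem :: "nat \<Rightarrow> (nat \<Rightarrow> 'a) \<Rightarrow> (nat \<Rightarrow> 'a) \<Rightarrow> ('a, 'k) tensor3" where
  "P_elem n x y = (\<Sum>i<n. \<Sum>j<n.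
      (pure3 (x i) (y i \<odot> x j) (y j) - pure3 (x i) (x j) (y i \<odot> y j)
       + pure3 (x i \<odot> x j) (y i) (y j) - pure3 (x i \<odot> x j) (y j) (y i)))"

definition L_elem :: "nat \<Rightarrow> (nat \<Rightarrow> 'a) \<Rightarrow> (nat \<Rightarrow> 'a) \<Rightarrow> ('a, 'k) tensor3" where
  "L_elem n x y = (\<Sum>i<n. \<Sum>j<n.
      (pure3 (x i \<star> x j) (y i) (y j) - pure3 (x i) (y i \<star> x j) (y j)
       - pure3 (x j) (x i \<star> y j) (y i) + pure3 (x j) (x i) (y i \<star> y j)))"

definition DPYBE :: "('a, 'k) tensor2 \<Rightarrow> bool" where
  "DPYBE r \<longleftrightarrow> (\<forall>n x y. r = (\<Sum>i<n. pure2 (x i) (y i)) \<longrightarrow> P_elem n x y = 0 \<and> L_elem n x y = 0)"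

lemma elem_cong:
  fixes \<phi> :: "'a \<Rightarrow> 'a \<Rightarrow> 'a \<Rightarrow> 'a \<Rightarrow> ('a, 'k) tensor3"
  assumes fd: "finite_dimensional_vector_space scale B"
    and lin: "\<And>b c d. Vector_Spaces.linear scale scale3 (\<lambda>a. \<phi> a b c d)"
      "\<And>a c d. Vector_Spaces.linear scale scale3 (\<lambda>b. \<phi> a b c d)"
      "\<And>a b d. Vector_Spaces.linear scale scale3 (\<lambda>c. \<phi> a b c d)"
      "\<And>a b c. Vector_Spaces.linear scale scale3 (\<lambda>d. \<phi> a b c d)"
    and eq: "(\<Sum>i\<in>I. pure2 (x i) (y i)) = (\<Sum>i\<in>I'. pure2 (x' i) (y' i))"
  shows "(\<Sum>i\<in>I. \<Sum>j\<in>I. \<phi> (x i) (y i) (x j) (y j)) =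
    (\<Sum>i\<in>I'. \<Sum>j\<in>I'. \<phi> (x' i) (y' i) (x' j) (y' j))"
proof -
  have "(\<Sum>j\<in>I. \<phi> a b (x j) (y j)) = (\<Sum>j\<in>I'. \<phi> a b (x' j) (y' j))" for a b
    by (rule tensors2_sum_cong[OF fd vector_space_scale3 lin(4) lin(3) eq])
  moreover have 2: "(\<Sum>i\<in>I. \<phi> (x i) (y i) c d) = (\<Sum>i\<in>I'. \<phi> (x' i) (y' i) c d)" for c d
    by (rule tensors2_sum_cong[OF fd vector_space_scale3 lin(2) lin(1) eq])
  ultimately have "(\<Sum>i\<in>I. \<Sum>j\<in>I. \<phi> (x i) (y i) (x j) (y j)) =
      (\<Sum>i\<in>I. \<Sum>j\<in>I'. \<phi> (x i) (y i) (x' j) (y' j))"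
    by simp
  also have "\<dots> = (\<Sum>j\<in>I'. \<Sum>i\<in>I. \<phi> (x i) (y i) (x' j) (y' j))"
    by (rule sum.swap)
  also have "\<dots> = (\<Sum>j\<in>I'. \<Sum>i\<in>I'. \<phi> (x' i) (y' i) (x' j) (y' j))"
    using 2 by simp
  also have "\<dots> = (\<Sum>i\<in>I'. \<Sum>j\<in>I'. \<phi> (x' i) (y' i) (x' j) (y' j))"
    by (rule sum.swap)
  finally show ?thesis .
qed

lemma DPYBE_iff:
  assumes fd: "finite_dimensional_vector_space scale B"
    and r: "r = (\<Sum>i<n. pure2 (x i) (y i))"
  shows "DPYBE r \<longleftrightarrow> P_elem n x y = 0 \<and> L_elem n x y = 0"
proof -
  interpret p: vector_space_pair scale scale3
    by (intro vector_space_pair.intro vector_space_axioms vector_space_scale3)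
  have ops: "(a + b) \<odot> c = a \<odot> c + b \<odot> c" "c \<odot> (a + b) = c \<odot> a + c \<odot> b"
      "scale k a \<odot> b = scale k (a \<odot> b)" "a \<odot> scale k b = scale k (a \<odot> b)"
      "(a + b) \<star> c = a \<star> c + b \<star> c" "c \<star> (a + b) = c \<star> a + c \<star> b"
      "scale k a \<star> b = scale k (a \<star> b)" "a \<star> scale k b = scale k (a \<star> b)" for a b c k
    using circ_bilinear ast_bilinear by (simp_all add: bilinear_op_def Vector_Spaces.linear_iff)
  note lin = Vector_Spaces.linear_iff vector_space_axioms vector_space_scale3 ops pure3_linear
  have P: "P_elem n x y = P_elem m x' y'"
    if "(\<Sum>i<n. pure2 (x i) (y i)) = (\<Sum>i<m. pure2 (x' i) (y' i))" for m x' y'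
    unfolding P_elem_def
    by (rule elem_cong[where \<phi> = "\<lambda>a b c d. pure3 a (b \<odot> c) d - pure3 a c (b \<odot> d)
       + pure3 (a \<odot> c) b d - pure3 (a \<odot> c) d b", OF fd _ _ _ _ that])
      (intro p.linear_compose_sub p.linear_compose_add; simp add: lin)+
  have L: "L_elem n x y = L_elem m x' y'"
    if "(\<Sum>i<n. pure2 (x i) (y i)) = (\<Sum>i<m. pure2 (x' i) (y' i))" for m x' y'
    unfolding L_elem_def
    by (rule elem_cong[where \<phi> = "\<lambda>a b c d. pure3 (a \<star> c) b d - pure3 a (b \<star> c) d
       - pure3 c (a \<star> d) b + pure3 c a (b \<star> d)", OF fd _ _ _ _ that])
      (intro p.linear_compose_sub p.linear_compose_add; simp add: lin)+
  show ?thesis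
  proof
    show "P_elem n x y = 0 \<and> L_elem n x y = 0" if "DPYBE r"
      using that r unfolding DPYBE_def by blast
    show "DPYBE r" if "P_elem n x y = 0 \<and> L_elem n x y = 0"
      unfolding DPYBE_def
    proof (intro allI impI)
      fix m :: nat and x' y'
      assume "r = (\<Sum>i<m. pure2 (x' i) (y' i))"
      then have eq: "(\<Sum>i<n. pure2 (x i) (y i)) = (\<Sum>i<m. pure2 (x' i) (y' i))"
        using r by simp
      show "P_elem m x' y' = 0 \<and> L_elem m x' y' = 0"
        using that P[OF eq] L[OF eq] by simp
    qed
  qed
qed

definition quasi_triangular :: "('a, 'k) tensor2 \<Rightarrow> bool" where
  "quasi_triangular r \<longleftrightarrow> r \<in> tensors2 \<and> DPP_bialgebra scale circ ast (nu_of r) (theta_of r) \<and>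
     DPYBE r \<and> DP_invariant (r - flip2 r)"

definition factorizable :: "('a, 'k) tensor2 \<Rightarrow> bool" where
  "factorizable r \<longleftrightarrow> quasi_triangular r \<and> dual_iso (I_of r)"

end

section \<open>Quadratic Rota-Baxter DPP algebras\<close>

locale quadratic_DPP_algebra = DPP_algebra scale circ ast
  for scale :: "'k::field_char_0 \<Rightarrow> 'a::ab_group_add \<Rightarrow> 'a"
    and circ :: "'a \<Rightarrow> 'a \<Rightarrow> 'a" (infixl \<open>\<odot>\<close> 70)
    and ast :: "'a \<Rightarrow> 'a \<Rightarrow> 'a" (infixl \<open>\<star>\<close> 70) +
  fixes \<omega> :: "'a \<Rightarrow> 'a \<Rightarrow> 'k"
  assumes omega_bilinear: "bilinear_form \<omega>"
    and omega_skew: "\<omega> a1 a2 = - \<omega> a2 a1"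
    and omega_nondegenerate: "(\<And>a2. \<omega> a1 a2 = 0) \<Longrightarrow> a1 = 0"
    and omega_circ: "\<omega> (a1 \<odot> a2) a3 = \<omega> a1 (a2 \<odot> a3 - a3 \<odot> a2)"
    and omega_ast: "\<omega> (a1 \<star> a2) a3 = \<omega> a1 (a2 \<star> a3 + a3 \<star> a2)"

locale quadratic_RB_DPP_algebra = quadratic_DPP_algebra scale circ ast \<omega>
  for scale :: "'k::field_char_0 \<Rightarrow> 'a::ab_group_add \<Rightarrow> 'a"
    and circ :: "'a \<Rightarrow> 'a \<Rightarrow> 'a" (infixl \<open>\<odot>\<close> 70)
    and ast :: "'a \<Rightarrow> 'a \<Rightarrow> 'a" (infixl \<open>\<star>\<close> 70)
    and \<omega> :: "'a \<Rightarrow> 'a \<Rightarrow> 'k" +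
  fixes R :: "'a \<Rightarrow> 'a" and lam :: 'k
  assumes R_linear: "Vector_Spaces.linear scale scale R"
    and R_circ: "R a1 \<odot> R a2 = R (R a1 \<odot> a2 + a1 \<odot> R a2 + scale lam (a1 \<odot> a2))"
    and R_ast: "R a1 \<star> R a2 = R (R a1 \<star> a2 + a1 \<star> R a2 + scale lam (a1 \<star> a2))"
    and R_omega: "\<omega> a1 (R a2) + \<omega> (R a1) a2 + lam * \<omega> a1 a2 = 0"

end

theory Submission
  imports Defs
begin

text \<open>A nondegenerate \<open>\<omega>\<close> identifies \<open>A\<^sup>*\<close> with \<open>A\<close>, under which \<open>r\<close> becomes a linear operator
  \<open>N = \<tau>(r)\<^sup>\<sharp>\<close> with \<open>r\<^sup>\<sharp> = N + id\<close> when \<open>\<omega>\<close> is the inverse of \<open>r\<^sup>\<sharp> - \<tau>(r)\<^sup>\<sharp>\<close>. Invariance of \<open>r - \<tau>(r)\<close> is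
  then invariance of \<open>\<omega>\<close>, and the DPYBE is the Rota-Baxter identity of weight \<open>1\<close> for \<open>N\<close>. Moreover
  \<open>\<nu>\<^sub>r\<close> and \<open>\<theta>\<^sub>r\<close> are dual to the descendent products \<open>N a \<cdot> b + a \<cdot> N b + a \<cdot> b\<close>, so the DPP coalgebra
  axioms say that these products form a DPP algebra, which the Rota-Baxter identity ensures.\<close>

section \<open>Functionals, membership in \<open>tensors2\<close>, and linearity of
  \<open>sharp\<close>\<close>

context tensor_space
begin

lemma dual_add: "\<xi> \<in> dual \<Longrightarrow> \<xi> (x + y) = \<xi> x + \<xi> y"
  by (simp add: dual_iff)

lemma dual_sub: "\<xi> \<in> dual \<Longrightarrow> \<xi> (x - y) = \<xi> x - \<xi> y"
  using dual_add[of \<xi> "x - y" y] by simp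

lemma dual_zero: "\<xi> \<in> dual \<Longrightarrow> \<xi> 0 = 0"
  using dual_sub[of \<xi> 0 0] by simp

lemma dual_minus: "\<xi> \<in> dual \<Longrightarrow> \<xi> (- x) = - \<xi> x"
  using dual_sub[of \<xi> 0 x] by (simp add: dual_zero)

lemmas dual_simps = dual_add dual_sub dual_minus dual_zero dual_scale

lemma tensors2_add: "s \<in> tensors2 \<Longrightarrow> t \<in> tensors2 \<Longrightarrow> s + t \<in> tensors2"
  unfolding tensors2_def by (rule t2.span_add)

lemma tensors2_diff: "s \<in> tensors2 \<Longrightarrow> t \<in> tensors2 \<Longrightarrow> s - t \<in> tensors2"
  unfolding tensors2_def by (rule t2.span_diff)

lemma tensors2_sum: "(\<And>i. i \<in> I \<Longrightarrow> t i \<in> tensors2) \<Longrightarrow> (\<Sum>i\<in>I. t i) \<in> tensors2"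
  unfolding tensors2_def by (rule t2.span_sum)

lemma map2_sum: "map2 f g (\<Sum>i\<in>I. t i) = (\<Sum>i\<in>I. map2 f g (t i))"
  by (auto simp: map2_def fun_eq_iff sum_tensor2_apply)

lemma flip2_sum: "flip2 (\<Sum>i\<in>I. t i) = (\<Sum>i\<in>I. flip2 (t i))"
  by (auto simp: flip2_def fun_eq_iff sum_tensor2_apply)

lemma tensors2_map2:
  assumes "Vector_Spaces.linear scale scale f" "Vector_Spaces.linear scale scale g" "t \<in> tensors2"
  shows "map2 f g t \<in> tensors2"
proof -
  obtain n :: nat and x y where "t = (\<Sum>i<n. pure2 (x i) (y i))"
    using tensors2_explicit[OF assms(3)] by blast
  then show ?thesis
    by (auto simp: map2_sum map2_pure2[OF assms(1,2)] intro!: tensors2_sum pure2_in)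
qed

lemma tensors2_flip2:
  assumes "t \<in> tensors2"
  shows "flip2 t \<in> tensors2"
proof -
  obtain n :: nat and x y where "t = (\<Sum>i<n. pure2 (x i) (y i))"
    using tensors2_explicit[OF assms] by blast
  then show ?thesis
    by (auto simp: flip2_sum flip2_pure2 intro!: tensors2_sum pure2_in)
qed

text \<open>The description operator in \<open>sharp\<close> is meaningful on
  \<open>tensors2\<close>: a finite presentation by pure tensors supplies the witness. Later
  arguments can then use this pairing rule instead of presentations.\<close>

lemma dual_sharp:
  assumes "t \<in> tensors2" "\<xi> \<in> dual" "\<eta> \<in> dual"
  shows "\<eta> (sharp t \<xi>) = t \<xi> \<eta>"
proof -
  obtain n :: nat and x y where "t = (\<Sum>i<n. pure2 (x i) (y i))"
    using tensors2_explicit[OF assms(1)] by blast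
  then show ?thesis
    using assms(2,3)
    by (simp add: sharp_sum_pure2 sum_tensor2_apply dual_sum)
      (simp add: pure2_def dual_scale)
qed

lemma sharp_eqI:
  assumes "\<And>\<eta>. \<eta> \<in> dual \<Longrightarrow> \<eta> a = t \<xi> \<eta>"
  shows "sharp t \<xi> = a"
  unfolding sharp_def by (rule the_equality) (auto simp: assms intro: dual_separates)

lemma add_dual: "\<xi> \<in> dual \<Longrightarrow> \<eta> \<in> dual \<Longrightarrow> \<xi> + \<eta> \<in> dual"
  by (simp add: dual_iff algebra_simps)

lemma scale_dual: "\<xi> \<in> dual \<Longrightarrow> (\<lambda>a. c * \<xi> a) \<in> dual"
  by (simp add: dual_iff algebra_simps)

lemma sharp_add:
  assumes "t \<in> tensors2" "\<xi> \<in> dual" "\<eta> \<in> dual"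
  shows "sharp t (\<xi> + \<eta>) = sharp t \<xi> + sharp t \<eta>"
proof -
  obtain n :: nat and x y where "t = (\<Sum>i<n. pure2 (x i) (y i))"
    using tensors2_explicit[OF assms(1)] by blast
  then show ?thesis
    using assms(2,3) by (simp add: sharp_sum_pure2 add_dual scale_left_distrib sum.distrib)
qed

lemma sharp_scale:
  assumes "t \<in> tensors2" "\<xi> \<in> dual"
  shows "sharp t (\<lambda>a. c * \<xi> a) = scale c (sharp t \<xi>)"
proof -
  obtain n :: nat and x y where "t = (\<Sum>i<n. pure2 (x i) (y i))"
    using tensors2_explicit[OF assms(1)] by blast
  then show ?thesis
    using assms(2) by (simp add: sharp_sum_pure2 scale_dual scale_sum_right)
qed

text \<open>For a finite basis \<open>B\<close> with coordinate functionals
  \<open>\<beta> b\<close>, a linear \<open>S\<close> is determined by its values on the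
  \<open>\<beta> b\<close>, and the tensor is the sum over \<open>B\<close> of
  \<open>pure2 b (S (\<beta> b))\<close>.\<close>

lemma tensor_of_in_tensors2:
  assumes fd: "finite_dimensional_vector_space scale B"
    and add: "\<And>\<xi> \<eta>. \<xi> \<in> dual \<Longrightarrow> \<eta> \<in> dual \<Longrightarrow> S (\<xi> + \<eta>) = S \<xi> + S \<eta>"
    and scl: "\<And>c \<xi>. \<xi> \<in> dual \<Longrightarrow> S (\<lambda>a. c * \<xi> a) = scale c (S \<xi>)"
  shows "tensor_of S \<in> tensors2"
proof -
  interpret B: finite_dimensional_vector_space scale B by (rule fd)
  note B = B.finite_Basis B.independent_Basis B.span_Basis
  define \<beta> where "\<beta> b = (\<lambda>x. representation B x b)" for b
  have \<beta>: "\<beta> b \<in> dual" for b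
    unfolding \<beta>_def using B by (intro coordinate_dual)
  have zero: "0 \<in> dual" by (simp add: dual_iff)
  have S0: "S 0 = 0" using add[OF zero zero] by simp
  \<comment> \<open>Additivity of \<open>S\<close> is available on \<open>dual\<close> only, so
    membership of the partial sums in \<open>dual\<close> is carried through the same
    induction.\<close>
  have S_sum: "(\<Sum>b\<in>C. (\<lambda>a. c b * \<beta> b a)) \<in> dual \<and>
      S (\<Sum>b\<in>C. (\<lambda>a. c b * \<beta> b a)) = (\<Sum>b\<in>C. scale (c b) (S (\<beta> b)))" if "finite C" for c C
    using that
  proof (induction C)
    case empty
    show ?case using zero S0 by (simp only: sum.empty)
  next
    case (insert d C)
    then show ?case
      by (simp only: sum.insert add[OF scale_dual[OF \<beta>]] scl[OF \<beta>]
          add_dual[OF scale_dual[OF \<beta>]] simp_thms)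
  qed
  \<comment> \<open>The coefficients of a functional in the dual basis are its values on the basis
    vectors.\<close>
  have expand: "\<xi> = (\<Sum>b\<in>B. (\<lambda>a. \<xi> b * \<beta> b a))" if "\<xi> \<in> dual" for \<xi>
  proof
    fix x
    have "\<xi> x = \<xi> (\<Sum>b\<in>B. scale (\<beta> b x) b)"
      using B by (simp add: \<beta>_def sum_representation_eq)
    also have "\<dots> = (\<Sum>b\<in>B. \<xi> b * \<beta> b x)"
      using that by (simp add: dual_sum dual_scale mult.commute)
    also have "\<dots> = (\<Sum>b\<in>B. (\<lambda>a. \<xi> b * \<beta> b a)) x"
      by (induction B rule: infinite_finite_induct) auto
    finally show "\<xi> x = (\<Sum>b\<in>B. (\<lambda>a. \<xi> b * \<beta> b a)) x" .
  qed
  have "S \<xi> = (\<Sum>b\<in>B. scale (\<xi> b) (S (\<beta> b)))" if "\<xi> \<in> dual" for \<xi>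
    using S_sum[OF B(1), of \<xi>] expand[OF that] by simp
  then have "tensor_of S = (\<Sum>b\<in>B. pure2 b (S (\<beta> b)))"
    by (auto simp: tensor_of_def fun_eq_iff sum_tensor2_apply pure2_def dual_sum dual_scale)
  then show ?thesis
    by (auto intro!: tensors2_sum pure2_in)
qed

end

section \<open>Right-nested normal forms and the descendent DPP algebra\<close>

context DPP_algebra
begin

lemma circ_simps:
  "(a + b) \<odot> c = a \<odot> c + b \<odot> c" "c \<odot> (a + b) = c \<odot> a + c \<odot> b"
  "scale k a \<odot> b = scale k (a \<odot> b)" "a \<odot> scale k b = scale k (a \<odot> b)"
  using circ_bilinear by (simp_all add: bilinear_op_def Vector_Spaces.linear_iff)

lemma ast_simps:
  "(a + b) \<star> c = a \<star> c + b \<star> c" "c \<star> (a + b) = c \<star> a + c \<star> b"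
  "scale k a \<star> b = scale k (a \<star> b)" "a \<star> scale k b = scale k (a \<star> b)"
  using ast_bilinear by (simp_all add: bilinear_op_def Vector_Spaces.linear_iff)

lemma circ_diff: "(a - b) \<odot> c = a \<odot> c - b \<odot> c" "c \<odot> (a - b) = c \<odot> a - c \<odot> b"
  using circ_simps(1)[of "a - b" b c] circ_simps(2)[of c "a - b" b] by (simp_all add: algebra_simps)

lemma ast_diff: "(a - b) \<star> c = a \<star> c - b \<star> c" "c \<star> (a - b) = c \<star> a - c \<star> b"
  using ast_simps(1)[of "a - b" b c] ast_simps(2)[of c "a - b" b] by (simp_all add: algebra_simps)

lemma circ_zero: "0 \<odot> c = 0" "c \<odot> 0 = 0"
  using circ_diff[of 0 0 c] circ_diff[of c 0 0] by simp_all

lemma ast_zero: "0 \<star> c = 0" "c \<star> 0 = 0"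
  using ast_diff[of 0 0 c] ast_diff[of c 0 0] by simp_all

lemma circ_minus: "(- a) \<odot> c = - (a \<odot> c)" "c \<odot> (- a) = - (c \<odot> a)"
  using circ_diff(1)[of 0 a c] circ_diff(2)[of c 0 a] by (simp_all add: circ_zero)

lemma ast_minus: "(- a) \<star> c = - (a \<star> c)" "c \<star> (- a) = - (c \<star> a)"
  using ast_diff(1)[of 0 a c] ast_diff(2)[of c 0 a] by (simp_all add: ast_zero)

lemmas op_simps =
  circ_simps circ_diff circ_minus circ_zero ast_simps ast_diff ast_minus ast_zero

lemma perm_left_commute: "a \<odot> (b \<odot> c) = b \<odot> (a \<odot> c)"
  by (simp add: perm_assoc perm_comm[of a b])

lemma ast_ast_left: "(a \<star> b) \<star> c = a \<star> (b \<star> c) - b \<star> (a \<star> c)"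
  using leibniz[of a b c] by simp

text \<open>Products of three elements are spanned by the right-nested ones, and \<open>commutator_skew\<close> below is
  the only relation between right-nested products that is not a symmetry of \<open>\<odot>\<close>.\<close>

lemmas right_nest = perm_assoc[symmetric] ast_ast_left circ_ast ast_circ

lemma commutator_skew:
  "b \<star> (a \<odot> c) = a \<odot> (b \<star> c) + b \<odot> (a \<star> c) - a \<star> (b \<odot> c)"
  using ast_circ_skew[of a b c] unfolding ast_circ by (simp add: algebra_simps)

lemma op_linear:
  "Vector_Spaces.linear scale scale (\<lambda>b. a \<odot> b)"
  "Vector_Spaces.linear scale scale (\<lambda>b. b \<odot> a)"
  "Vector_Spaces.linear scale scale (\<lambda>b. a \<star> b)"
  "Vector_Spaces.linear scale scale (\<lambda>b. b \<star> a)"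
  "Vector_Spaces.linear scale scale ((\<lambda>b. a \<odot> b) - (\<lambda>b. b \<odot> a))"
  "Vector_Spaces.linear scale scale ((\<lambda>b. b \<odot> a) - (\<lambda>b. a \<odot> b))"
  "Vector_Spaces.linear scale scale ((\<lambda>b. a \<star> b) + (\<lambda>b. b \<star> a))"
  by (auto simp: Vector_Spaces.linear_iff op_simps vector_space_axioms algebra_simps)

lemma id_linear: "Vector_Spaces.linear scale scale id"
  by (auto simp: Vector_Spaces.linear_iff vector_space_axioms)

lemma G_in_tensors2: "t \<in> tensors2 \<Longrightarrow> G a t \<in> tensors2"
  unfolding G_def by (intro tensors2_add tensors2_map2 op_linear id_linear)

lemma F_in_tensors2: "t \<in> tensors2 \<Longrightarrow> F a t \<in> tensors2"
  unfolding F_def by (intro tensors2_diff tensors2_map2 op_linear id_linear)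

text \<open>By the Rota-Baxter identity \<open>N\<close> maps each descendent product to the
  original product of the images. This eliminates every \<open>N\<close> applied to a product, and
  each axiom becomes an identity of right-nested words in the arguments and their images under
  \<open>N\<close>.\<close>

lemma descendent_DPP_algebra:
  assumes N: "Vector_Spaces.linear scale scale N"
    and N_circ: "\<And>a b. N a \<odot> N b = N (N a \<odot> b + a \<odot> N b + a \<odot> b)"
    and N_ast: "\<And>a b. N a \<star> N b = N (N a \<star> b + a \<star> N b + a \<star> b)"
  shows "DPP_algebra scale (\<lambda>a b. N a \<odot> b + a \<odot> N b + a \<odot> b)
    (\<lambda>a b. N a \<star> b + a \<star> N b + a \<star> b)"
proof -
  have N_simps: "N (x + y) = N x + N y" "N (scale c x) = scale c (N x)" for x y c
    using N by (simp_all add: Vector_Spaces.linear_iff)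
  \<comment> \<open>The Rota-Baxter identities appear both with \<open>N\<close> outside the sum and
    with \<open>N\<close> distributed over it, since additivity of \<open>N\<close> may split the
    sum first.\<close>
  note expand = N_simps N_circ[symmetric] N_ast[symmetric]
    N_circ[symmetric, unfolded N_simps] N_ast[symmetric, unfolded N_simps]
    op_simps right_nest perm_left_commute
  show ?thesis
    apply unfold_locales
           apply (auto simp: bilinear_op_def Vector_Spaces.linear_iff op_simps N_simps
        vector_space_axioms algebra_simps)[2]
         apply (simp add: expand)
        apply (simp add: expand)
       apply (simp add: expand)
      apply (simp add: expand)
     apply (simp add: expand)
    \<comment> \<open>Left general, \<open>commutator_skew\<close> would rewrite its own last term
      back. It is therefore oriented at the four pairs that occur, each argument entering either as
      itself or through \<open>N\<close>.\<close>
    subgoal for a b c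
      by (simp add: expand commutator_skew[of b a] commutator_skew[of b "N a"]
          commutator_skew[of "N b" a] commutator_skew[of "N b" "N a"])
    done
qed

lemma comp_dual: "\<eta> \<in> dual \<Longrightarrow> \<eta> \<circ> (\<lambda>x. a \<odot> x) \<in> dual"
  "\<eta> \<in> dual \<Longrightarrow> \<eta> \<circ> (\<lambda>x. x \<odot> a) \<in> dual"
  "\<eta> \<in> dual \<Longrightarrow> \<eta> \<circ> ((\<lambda>x. a \<odot> x) - (\<lambda>x. x \<odot> a)) \<in> dual"
  "\<eta> \<in> dual \<Longrightarrow> \<eta> \<circ> ((\<lambda>x. x \<odot> a) - (\<lambda>x. a \<odot> x)) \<in> dual"
  "\<eta> \<in> dual \<Longrightarrow> \<eta> \<circ> (\<lambda>x. a \<star> x) \<in> dual"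
  "\<eta> \<in> dual \<Longrightarrow> \<eta> \<circ> (\<lambda>x. x \<star> a) \<in> dual"
  "\<eta> \<in> dual \<Longrightarrow> \<eta> \<circ> ((\<lambda>x. a \<star> x) + (\<lambda>x. x \<star> a)) \<in> dual"
  by (intro dual_comp op_linear; assumption)+

end

section \<open>The form as an identification of the dual with the algebra\<close>

context quadratic_DPP_algebra
begin

lemma omega_dual: "\<omega> b \<in> dual"
  using omega_bilinear by (simp add: bilinear_form_def dual_def)

lemma omega_simps:
  "\<omega> (x + y) z = \<omega> x z + \<omega> y z" "\<omega> (scale c x) z = c * \<omega> x z"
  "\<omega> z (x + y) = \<omega> z x + \<omega> z y" "\<omega> z (scale c x) = c * \<omega> z x"
  "\<omega> z (x - y) = \<omega> z x - \<omega> z y" "\<omega> z (- x) = - \<omega> z x"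
proof -
  show "\<omega> z (x + y) = \<omega> z x + \<omega> z y" "\<omega> z (scale c x) = c * \<omega> z x"
    "\<omega> z (x - y) = \<omega> z x - \<omega> z y" "\<omega> z (- x) = - \<omega> z x"
    by (simp_all add: omega_dual dual_simps)
  have "(\<lambda>a. \<omega> a z) \<in> dual"
    using omega_bilinear by (simp add: bilinear_form_def dual_def)
  then show "\<omega> (x + y) z = \<omega> x z + \<omega> y z" "\<omega> (scale c x) z = c * \<omega> x z"
    by (simp_all add: dual_iff)
qed

lemma omega_simps_left:
  "\<omega> (x - y) z = \<omega> x z - \<omega> y z" "\<omega> (- x) z = - \<omega> x z"
  by (simp_all only: omega_skew[of _ z] omega_simps) simp

lemma omega_inj: "\<omega> x = \<omega> y \<Longrightarrow> x = y"
  using omega_nondegenerate[of "x - y"] by (simp add: omega_simps_left)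

text \<open>A dimension argument: a functional is encoded as the vector whose coordinates are its
  values on \<open>B\<close>. This turns \<open>\<omega>\<close> into an endomorphism
  \<open>f\<close> of the algebra, injective by nondegeneracy and hence surjective.\<close>

lemma omega_onto:
  assumes fd: "finite_dimensional_vector_space scale B" and \<xi>: "\<xi> \<in> dual"
  shows "\<exists>b. \<xi> = \<omega> b"
proof -
  interpret B: finite_dimensional_vector_space scale B by (rule fd)
  note B = B.finite_Basis B.independent_Basis B.span_Basis
  have eqI: "\<eta> = \<zeta>" if "\<eta> \<in> dual" "\<zeta> \<in> dual" "\<And>b. b \<in> B \<Longrightarrow> \<eta> b = \<zeta> b" for \<eta> \<zeta>
  proof
    fix x
    have x: "x = (\<Sum>b\<in>B. scale (representation B x b) b)"
      using B by (simp add: sum_representation_eq)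
    have "\<eta> (\<Sum>b\<in>B. scale (representation B x b) b) = \<zeta> (\<Sum>b\<in>B. scale (representation B x b) b)"
      using that by (simp add: dual_sum dual_scale)
    then show "\<eta> x = \<zeta> x" using x by simp
  qed
  define f where "f a = (\<Sum>b\<in>B. scale (\<omega> a b) b)" for a
  have coords: "u b = v b" if "(\<Sum>b\<in>B. scale (u b) b) = (\<Sum>b\<in>B. scale (v b) b)" "b \<in> B" for u v b
    using independentD[OF B(2,1) order_refl, of "\<lambda>b. u b - v b" b] that
    by (simp add: scale_left_diff_distrib sum_subtractf)
  have lin: "Vector_Spaces.linear scale scale f"
    by (auto simp: Vector_Spaces.linear_iff vector_space_axioms f_def omega_simps
        scale_left_distrib sum.distrib scale_sum_right)
  have "inj f"
  proof (rule injI)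
    fix x y
    assume "f x = f y"
    then have "\<omega> x b = \<omega> y b" if "b \<in> B" for b
      using coords[of "\<omega> x" "\<omega> y"] that by (simp add: f_def)
    then have "\<omega> x = \<omega> y" by (rule eqI[OF omega_dual omega_dual])
    then show "x = y" by (rule omega_inj)
  qed
  then have "surj f" by (rule B.linear_inj_imp_surj[OF lin])
  then obtain b where "f b = (\<Sum>b\<in>B. scale (\<xi> b) b)" by (metis surjD)
  then have "\<omega> b c = \<xi> c" if "c \<in> B" for c
    using coords[of "\<omega> b" \<xi>] that by (simp add: f_def)
  then show ?thesis using eqI[OF \<xi> omega_dual] by metis
qed

text \<open>These are the transposes of the multiplication operators under the identification.
  Invariance gives the combinations \<open>L - Rc\<close> and \<open>Lt + Rt\<close>; skew-symmetry
  applied to invariance in the other slot gives the right multiplications; subtraction then gives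
  the left ones.\<close>

lemma omega_comp:
  "\<omega> b \<circ> (\<lambda>x. a \<odot> x) = \<omega> (a \<odot> b)"
  "\<omega> b \<circ> (\<lambda>x. x \<odot> a) = \<omega> (a \<odot> b - b \<odot> a)"
  "\<omega> b \<circ> ((\<lambda>x. a \<odot> x) - (\<lambda>x. x \<odot> a)) = \<omega> (b \<odot> a)"
  "\<omega> b \<circ> ((\<lambda>x. x \<odot> a) - (\<lambda>x. a \<odot> x)) = \<omega> (- (b \<odot> a))"
  "\<omega> b \<circ> (\<lambda>x. a \<star> x) = \<omega> (- (a \<star> b))"
  "\<omega> b \<circ> (\<lambda>x. x \<star> a) = \<omega> (a \<star> b + b \<star> a)"
  "\<omega> b \<circ> ((\<lambda>x. a \<star> x) + (\<lambda>x. x \<star> a)) = \<omega> (b \<star> a)"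
proof -
  have c1: "\<omega> b (a \<odot> x) - \<omega> b (x \<odot> a) = \<omega> (b \<odot> a) x" for x
    by (simp add: omega_circ omega_simps)
  have c2: "\<omega> b (x \<odot> a) = \<omega> (a \<odot> b - b \<odot> a) x" for x
    using omega_circ[of x a b] omega_skew[of "x \<odot> a" b] omega_skew[of x "a \<odot> b - b \<odot> a"] by simp
  have c3: "\<omega> b (a \<star> x) + \<omega> b (x \<star> a) = \<omega> (b \<star> a) x" for x
    by (simp add: omega_ast omega_simps)
  have c4: "\<omega> b (x \<star> a) = \<omega> (a \<star> b + b \<star> a) x" for x
    using omega_ast[of x a b] omega_skew[of "x \<star> a" b] omega_skew[of x "a \<star> b + b \<star> a"] by simp
  have "\<omega> b (a \<odot> x) = \<omega> (a \<odot> b) x" for x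
    using c1[of x] c2[of x] by (simp add: omega_simps_left)
  moreover have "\<omega> b (a \<star> x) = \<omega> (- (a \<star> b)) x" for x
    using c3[of x] c4[of x] by (simp add: omega_simps_left omega_simps eq_neg_iff_add_eq_0)
  moreover have "\<omega> b (x \<odot> a) - \<omega> b (a \<odot> x) = \<omega> (- (b \<odot> a)) x" for x
    using c1[of x] by (simp add: omega_simps_left algebra_simps)
  moreover note c1 c2 c3 c4
  ultimately show
    "\<omega> b \<circ> (\<lambda>x. a \<odot> x) = \<omega> (a \<odot> b)"
    "\<omega> b \<circ> (\<lambda>x. x \<odot> a) = \<omega> (a \<odot> b - b \<odot> a)"
    "\<omega> b \<circ> ((\<lambda>x. a \<odot> x) - (\<lambda>x. x \<odot> a)) = \<omega> (b \<odot> a)"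
    "\<omega> b \<circ> ((\<lambda>x. x \<odot> a) - (\<lambda>x. a \<odot> x)) = \<omega> (- (b \<odot> a))"
    "\<omega> b \<circ> (\<lambda>x. a \<star> x) = \<omega> (- (a \<star> b))"
    "\<omega> b \<circ> (\<lambda>x. x \<star> a) = \<omega> (a \<star> b + b \<star> a)"
    "\<omega> b \<circ> ((\<lambda>x. a \<star> x) + (\<lambda>x. x \<star> a)) = \<omega> (b \<star> a)"
    by (simp_all only: fun_eq_iff comp_apply minus_apply plus_fun_apply omega_simps(3,5) simp_thms)
qed

lemma omega_left_mult:
  "\<omega> b (a \<odot> x) = \<omega> (a \<odot> b) x" "\<omega> b (a \<star> x) = - \<omega> (a \<star> b) x"
  using fun_cong[OF omega_comp(1)[of b a], of x] fun_cong[OF omega_comp(5)[of b a], of x]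
  by (simp_all add: omega_simps_left)

end

text \<open>Identifying \<open>A\<^sup>*\<close> with \<open>A\<close> by \<open>\<omega>\<close>, the operator \<open>N\<close> is \<open>\<tau>(r)\<^sup>\<sharp>\<close> and \<open>N + id\<close> is \<open>r\<^sup>\<sharp>\<close>; in the two
  directions of the theorem, \<open>R = \<lambda> N\<close>.\<close>

locale quadratic_tensor = quadratic_DPP_algebra scale circ ast \<omega>
  for scale :: "'k::field_char_0 \<Rightarrow> 'a::ab_group_add \<Rightarrow> 'a"
    and circ :: "'a \<Rightarrow> 'a \<Rightarrow> 'a" (infixl \<open>\<odot>\<close> 70)
    and ast :: "'a \<Rightarrow> 'a \<Rightarrow> 'a" (infixl \<open>\<star>\<close> 70)
    and \<omega> :: "'a \<Rightarrow> 'a \<Rightarrow> 'k" +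
  fixes Basis :: "'a set" and r :: "('a, 'k) tensor2" and N :: "'a \<Rightarrow> 'a"
  assumes finite_dim: "finite_dimensional_vector_space scale Basis"
    and r_tensors: "r \<in> tensors2"
    and N_linear: "Vector_Spaces.linear scale scale N"
    and r_omega_left: "\<eta> \<in> dual \<Longrightarrow> r (\<omega> b) \<eta> = \<eta> (N b + b)"
    and r_omega_right: "\<eta> \<in> dual \<Longrightarrow> r \<eta> (\<omega> b) = \<eta> (N b)"
begin

section \<open>The cobrackets expressed through \<open>N\<close>\<close>

lemma N_simps:
  "N (x + y) = N x + N y" "N (scale c x) = scale c (N x)" "N (x - y) = N x - N y" "N (- x) = - N x"
  "N 0 = 0"
proof -
  show add: "N (x + y) = N x + N y" and scl: "N (scale c x) = scale c (N x)" for x y c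
    using N_linear by (simp_all add: Vector_Spaces.linear_iff)
  show diff: "N (x - y) = N x - N y" for x y
    using add[of "x - y" y] by (simp add: algebra_simps)
  show "N 0 = 0" using diff[of 0 0] by simp
  then show "N (- x) = - N x" using diff[of 0 x] by simp
qed

text \<open>The left and right rules both evaluate \<open>r\<close> on a pair of
  \<open>\<omega>\<close>-images. Skew-symmetry turns their agreement into the compatibility of
  \<open>N\<close> with the form, of weight 1.\<close>

lemma omega_N: "\<omega> a (N b) + \<omega> (N a) b + \<omega> a b = 0"
  using r_omega_left[OF omega_dual, of a b] r_omega_right[OF omega_dual, of a b]
    omega_skew[of a b] omega_skew[of "N a" b]
  by (simp add: omega_simps)

lemma nu_of_omega:
  assumes "\<eta> \<in> dual"
  shows "nu_of r a (\<omega> b) \<eta> = \<eta> (N b \<odot> a - N (b \<odot> a))"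
  using assms
  by (simp add: nu_of_def G_def map2_def comp_dual omega_comp omega_dual r_omega_left
      N_simps op_simps dual_simps)

lemma theta_of_omega:
  assumes "\<eta> \<in> dual"
  shows "theta_of r a (\<omega> b) \<eta> = \<eta> (N (b \<star> a) - N b \<star> a)"
  using assms
  by (simp add: theta_of_def F_def map2_def comp_dual omega_comp omega_dual r_omega_left
      N_simps op_simps dual_simps)

lemma omega_N_right: "\<omega> a (N b) = - \<omega> (N a) b - \<omega> a b"
  using omega_N[of a b] by (simp add: algebra_simps eq_neg_iff_add_eq_0)

lemma nu_of_omega_omega:
  "nu_of r a (\<omega> b) (\<omega> c) = \<omega> (N b \<odot> c + b \<odot> N c + b \<odot> c) a"
  by (simp add: nu_of_omega[OF omega_dual] omega_simps omega_N_right omega_left_mult)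

lemma theta_of_omega_omega:
  "theta_of r a (\<omega> b) (\<omega> c) = \<omega> (N b \<star> c + b \<star> N c + b \<star> c) a"
  by (simp add: theta_of_omega[OF omega_dual] omega_simps omega_N_right omega_left_mult)

text \<open>Only the first argument is written as an \<open>\<omega>\<close>-image. The second
  remains an arbitrary functional, so that a tensor identity becomes an identity between elements of
  the algebra. The other two premises cover the default values outside \<open>dual\<close>.\<close>

lemma tensor2_eqI:
  assumes "\<And>b \<eta>. \<eta> \<in> dual \<Longrightarrow> s (\<omega> b) \<eta> = t (\<omega> b) \<eta>"
    and "\<And>\<xi> \<eta>. \<xi> \<notin> dual \<Longrightarrow> s \<xi> \<eta> = t \<xi> \<eta>"
    and "\<And>\<xi> \<eta>. \<eta> \<notin> dual \<Longrightarrow> s \<xi> \<eta> = t \<xi> \<eta>"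
  shows "s = t"
proof (intro ext)
  fix \<xi> \<eta>
  show "s \<xi> \<eta> = t \<xi> \<eta>"
    using assms omega_onto[OF finite_dim, of \<xi>] by (cases "\<xi> \<in> dual \<and> \<eta> \<in> dual") auto
qed

lemma nu_of_outside: "\<xi> \<notin> dual \<or> \<eta> \<notin> dual \<Longrightarrow> nu_of r a \<xi> \<eta> = 0"
  by (auto simp: nu_of_def G_def map2_def)

lemma theta_of_outside: "\<xi> \<notin> dual \<or> \<eta> \<notin> dual \<Longrightarrow> theta_of r a \<xi> \<eta> = 0"
  by (auto simp: theta_of_def F_def map2_def)

text \<open>Under \<open>flip2\<close> an \<open>\<omega>\<close>-image moves to the second slot;
  this rule and the next evaluate the flipped terms of the bialgebra conditions.\<close>

lemma nu_of_omega_right: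
  assumes "\<eta> \<in> dual"
  shows "nu_of r a \<eta> (\<omega> c) = \<eta> (N (a \<odot> c - c \<odot> a) + N c \<odot> a - a \<odot> N c)"
  using assms
  by (simp add: nu_of_def G_def map2_def comp_dual omega_comp omega_dual r_omega_right
      N_simps op_simps dual_simps)

lemma theta_of_omega_right:
  assumes "\<eta> \<in> dual"
  shows "theta_of r a \<eta> (\<omega> c) = \<eta> (a \<star> N c + N c \<star> a - N (a \<star> c + c \<star> a))"
  using assms
  by (simp add: theta_of_def F_def map2_def comp_dual omega_comp omega_dual r_omega_right
      N_simps op_simps dual_simps)

lemma tensor2_apply:
  "(s + t) \<xi> \<eta> = s \<xi> \<eta> + t \<xi> \<eta>" "(s - t) \<xi> \<eta> = s \<xi> \<eta> - t \<xi> \<eta>" "(- s) \<xi> \<eta> = - s \<xi> \<eta>"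
  for s t :: "('a, 'k) tensor2"
  by auto

lemmas tensor_eval =
  nu_of_omega theta_of_omega nu_of_omega_right theta_of_omega_right nu_of_outside theta_of_outside
  omega_comp comp_dual omega_dual map2_def flip2_def tensor2_apply

lemmas DPP_normal_form = N_simps op_simps right_nest perm_left_commute dual_simps

lemma nu_of_linear: "Vector_Spaces.linear scale scale2 (nu_of r)"
  unfolding Vector_Spaces.linear_iff
  by (intro conjI allI vector_space_axioms vector_space_scale2 tensor2_eqI;
      simp add: nu_of_omega nu_of_outside scale2_def DPP_normal_form algebra_simps)

lemma theta_of_linear: "Vector_Spaces.linear scale scale2 (theta_of r)"
  unfolding Vector_Spaces.linear_iff
  by (intro conjI allI vector_space_axioms vector_space_scale2 tensor2_eqI;
      simp add: theta_of_omega theta_of_outside scale2_def DPP_normal_form algebra_simps)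

section \<open>The coalgebra axioms as axioms of the descendent products\<close>

definition descendent_circ :: "'a \<Rightarrow> 'a \<Rightarrow> 'a" (infixl \<open>\<odot>\<^sub>N\<close> 70)
  where "a \<odot>\<^sub>N b = N a \<odot> b + a \<odot> N b + a \<odot> b"

definition descendent_ast :: "'a \<Rightarrow> 'a \<Rightarrow> 'a" (infixl \<open>\<star>\<^sub>N\<close> 70)
  where "a \<star>\<^sub>N b = N a \<star> b + a \<star> N b + a \<star> b"

text \<open>\<open>comult_id\<close> and \<open>id_comult\<close> feed such functionals back into a
  tensor. Recognizing them as \<open>\<omega>\<close>-images turns an iterated coproduct into an
  iterated descendent product.\<close>

lemma nu_of_functional: "(\<lambda>a. nu_of r a (\<omega> b) (\<omega> c)) = \<omega> (b \<odot>\<^sub>N c)"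
  by (simp add: nu_of_omega_omega fun_eq_iff descendent_circ_def)

lemma theta_of_functional: "(\<lambda>a. theta_of r a (\<omega> b) (\<omega> c)) = \<omega> (b \<star>\<^sub>N c)"
  by (simp add: theta_of_omega_omega fun_eq_iff descendent_ast_def)

lemma tensor3_eqI:
  assumes "\<And>b c d. s (\<omega> b) (\<omega> c) (\<omega> d) = t (\<omega> b) (\<omega> c) (\<omega> d)"
    and "\<And>\<xi> \<eta> \<zeta>. \<xi> \<notin> dual \<Longrightarrow> s \<xi> \<eta> \<zeta> = t \<xi> \<eta> \<zeta>"
    and "\<And>\<xi> \<eta> \<zeta>. \<eta> \<notin> dual \<Longrightarrow> s \<xi> \<eta> \<zeta> = t \<xi> \<eta> \<zeta>"
    and "\<And>\<xi> \<eta> \<zeta>. \<zeta> \<notin> dual \<Longrightarrow> s \<xi> \<eta> \<zeta> = t \<xi> \<eta> \<zeta>"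
  shows "s = t"
proof (intro ext)
  fix \<xi> \<eta> \<zeta>
  show "s \<xi> \<eta> \<zeta> = t \<xi> \<eta> \<zeta>"
    using assms omega_onto[OF finite_dim, of \<xi>] omega_onto[OF finite_dim, of \<eta>]
      omega_onto[OF finite_dim, of \<zeta>]
    by (cases "\<xi> \<in> dual \<and> \<eta> \<in> dual \<and> \<zeta> \<in> dual") auto
qed

lemma tensor3_apply:
  "(s + t) \<xi> \<eta> \<zeta> = s \<xi> \<eta> \<zeta> + t \<xi> \<eta> \<zeta>" "(- s) \<xi> \<eta> \<zeta> = - s \<xi> \<eta> \<zeta>" "0 \<xi> \<eta> \<zeta> = 0"
  for s t :: "('a, 'k) tensor3"
  by auto

text \<open>Evaluated on three \<open>\<omega>\<close>-images, each coalgebra axiom at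
  \<open>a\<close> is the form applied to an algebra identity for the descendent products and paired
  with \<open>a\<close>. \<open>comult_id\<close> yields products nested to the left,
  \<open>id_comult\<close> products nested to the right.\<close>

lemma DPP_coalgebra_of_descendent:
  assumes "DPP_algebra scale descendent_circ descendent_ast"
  shows "DPP_coalgebra scale (nu_of r) (theta_of r)"
proof -
  interpret D: DPP_algebra scale descendent_circ descendent_ast by (rule assms)
  have nu_theta: "nu_of r a (\<omega> b) (\<omega> c) = \<omega> (b \<odot>\<^sub>N c) a"
      "theta_of r a (\<omega> b) (\<omega> c) = \<omega> (b \<star>\<^sub>N c) a" for a b c
    by (simp_all add: nu_of_omega_omega theta_of_omega_omega descendent_circ_def descendent_ast_def)
  note evaluate = nu_theta comult_id_def id_comult_def flip12_def tensor3_apply omega_dual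
    nu_of_functional theta_of_functional omega_simps omega_simps_left
  show ?thesis
  proof (intro DPP_coalgebra.intro DPP_coalgebra_axioms.intro tensor_space_axioms
      nu_of_linear theta_of_linear)
    show "nu_of r a \<in> tensors2" "theta_of r a \<in> tensors2" for a
      by (simp_all add: nu_of_def theta_of_def G_in_tensors2 F_in_tensors2 r_tensors)
    show "comult_id (nu_of r) (nu_of r a) = id_comult (nu_of r) (nu_of r a)" for a
      by (rule tensor3_eqI; simp add: evaluate D.perm_assoc)
    show "id_comult (nu_of r) (nu_of r a) = flip12 (id_comult (nu_of r) (nu_of r a))" for a
      by (rule tensor3_eqI; simp add: evaluate D.perm_left_commute)
    show "id_comult (theta_of r) (theta_of r a) =
        comult_id (theta_of r) (theta_of r a) + flip12 (id_comult (theta_of r) (theta_of r a))" for a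
      by (rule tensor3_eqI; simp add: evaluate D.ast_ast_left)
    \<comment> \<open>Dualizing crosses the two mixed axioms: \<open>co_circ_ast\<close> comes from
      \<open>ast_circ\<close>, and \<open>co_ast_circ\<close> from \<open>circ_ast\<close>.\<close>
    show "id_comult (nu_of r) (theta_of r a) =
        comult_id (theta_of r) (nu_of r a) + flip12 (id_comult (theta_of r) (nu_of r a))" for a
      by (rule tensor3_eqI; simp add: evaluate D.ast_circ)
    show "comult_id (nu_of r) (theta_of r a) =
        id_comult (theta_of r) (nu_of r a) + flip12 (id_comult (theta_of r) (nu_of r a))" for a
      by (rule tensor3_eqI; simp add: evaluate D.circ_ast)
    \<comment> \<open>As a rewrite rule the skewness axiom would apply again to its own result, so
      it is used at a single instance.\<close>
    show "comult_id (theta_of r) (nu_of r a) = - flip12 (comult_id (theta_of r) (nu_of r a))" for a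
    proof (rule tensor3_eqI)
      fix b c d
      show "comult_id (theta_of r) (nu_of r a) (\<omega> b) (\<omega> c) (\<omega> d) =
          (- flip12 (comult_id (theta_of r) (nu_of r a))) (\<omega> b) (\<omega> c) (\<omega> d)"
        using D.ast_circ_skew[of b c d] by (simp add: evaluate)
    qed (simp_all add: evaluate)
  qed
qed

text \<open>The compatibility conditions are linear in \<open>r\<close>, so they need no Rota-Baxter identity for \<open>N\<close> and
  reduce to identities between products of three elements.\<close>

lemma DPP_bialgebra_of_coalgebra:
  assumes "DPP_coalgebra scale (nu_of r) (theta_of r)"
  shows "DPP_bialgebra scale circ ast (nu_of r) (theta_of r)"
  apply (intro DPP_bialgebra.intro DPP_algebra_axioms DPP_bialgebra_axioms.intro assms)
  subgoal for a1 a2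
    by (rule tensor2_eqI; simp add: tensor_eval DPP_normal_form)
  subgoal for a1 a2
    by (rule tensor2_eqI; simp add: tensor_eval DPP_normal_form)
  subgoal for a1 a2
    by (rule tensor2_eqI; simp add: tensor_eval DPP_normal_form)
  subgoal for a1 a2
    by (rule tensor2_eqI; simp add: tensor_eval DPP_normal_form)
  subgoal for a1 a2
    by (rule tensor2_eqI; simp add: tensor_eval DPP_normal_form)
  \<comment> \<open>From here on the conditions mix the two products. Fixing \<open>a1\<close> as
    the inner factor orients \<open>commutator_skew\<close> so that it does not undo itself.\<close>
  subgoal for a1 a2
    by (rule tensor2_eqI; simp add: tensor_eval DPP_normal_form commutator_skew[of _ a1])
  subgoal for a1 a2
    by (rule tensor2_eqI; simp add: tensor_eval DPP_normal_form commutator_skew[of _ a1])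
  subgoal for a1 a2
    by (rule tensor2_eqI; simp add: tensor_eval DPP_normal_form commutator_skew[of _ a1])
  subgoal for a1 a2
    by (rule tensor2_eqI; simp add: tensor_eval DPP_normal_form commutator_skew[of _ a1])
  subgoal for a1 a2
    by (rule tensor2_eqI; simp add: tensor_eval DPP_normal_form commutator_skew[of _ a1])
  subgoal for a1 a2
    by (rule tensor2_eqI; simp add: tensor_eval DPP_normal_form commutator_skew[of _ a1])
  subgoal for a1 a2
    by (rule tensor2_eqI; simp add: tensor_eval DPP_normal_form commutator_skew[of _ a1])
  done

end

section \<open>The two sides of the DPYBE as trilinear forms\<close>

context DPP_algebra
begin

lemma dual_bilinear_sum:
  assumes "bilinear_op m" "\<eta> \<in> dual"
  shows "\<eta> (m (\<Sum>i\<in>I. scale (f i) (u i)) (\<Sum>j\<in>J. scale (g j) (v j))) =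
    (\<Sum>i\<in>I. \<Sum>j\<in>J. f i * g j * \<eta> (m (u i) (v j)))"
proof -
  interpret p: vector_space_pair scale scale ..
  have l: "Vector_Spaces.linear scale scale (m a)" "Vector_Spaces.linear scale scale (\<lambda>a. m a b)" for a b
    using assms(1) by (simp_all add: bilinear_op_def)
  have left: "\<eta> (m (\<Sum>i\<in>I. scale (f i) (u i)) w) = (\<Sum>i\<in>I. f i * \<eta> (m (u i) w))" for w
    by (simp only: p.linear_sum[OF l(2)] p.linear_scale[OF l(2)]
        dual_sum[OF assms(2)] dual_scale[OF assms(2)])
  have right: "\<eta> (m w (\<Sum>j\<in>J. scale (g j) (v j))) = (\<Sum>j\<in>J. g j * \<eta> (m w (v j)))" for w
    by (simp only: p.linear_sum[OF l(1)] p.linear_scale[OF l(1)]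
        dual_sum[OF assms(2)] dual_scale[OF assms(2)])
  show ?thesis
    by (simp only: left) (simp only: right sum_distrib_left mult.assoc)
qed

text \<open>In every summand two of the three functionals meet bare legs of the two copies of
  \<open>r\<close>. They contract these copies to values of \<open>T\<close> or \<open>S\<close>,
  and the third functional is left acting on the product of the two values.\<close>

lemma elem_apply:
  fixes n :: nat
  assumes r: "r = (\<Sum>i<n. pure2 (x i) (y i))"
    and dual: "\<xi> \<in> dual" "\<eta> \<in> dual" "\<zeta> \<in> dual"
  defines "T \<equiv> sharp r" and "S \<equiv> sharp (flip2 r)"
  shows P_elem_apply: "P_elem n x y \<xi> \<eta> \<zeta> =
      \<eta> (T \<xi> \<odot> S \<zeta>) - \<zeta> (T \<xi> \<odot> T \<eta>) + \<xi> (S \<eta> \<odot> S \<zeta>) - \<xi> (S \<zeta> \<odot> S \<eta>)"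
    and L_elem_apply: "L_elem n x y \<xi> \<eta> \<zeta> =
      \<xi> (S \<eta> \<star> S \<zeta>) - \<eta> (T \<xi> \<star> S \<zeta>) - \<eta> (S \<zeta> \<star> T \<xi>) + \<zeta> (T \<eta> \<star> T \<xi>)"
proof -
  have T: "T \<phi> = (\<Sum>i<n. scale (\<phi> (x i)) (y i))" and S: "S \<phi> = (\<Sum>i<n. scale (\<phi> (y i)) (x i))"
    if "\<phi> \<in> dual" for \<phi>
    using that by (simp_all add: T_def S_def r flip2_sum flip2_pure2 sharp_sum_pure2)
  have app: "(s + t) \<xi> \<eta> \<zeta> = s \<xi> \<eta> \<zeta> + t \<xi> \<eta> \<zeta>" "(s - t) \<xi> \<eta> \<zeta> = s \<xi> \<eta> \<zeta> - t \<xi> \<eta> \<zeta>"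
    for s t :: "('a, 'k) tensor3"
    by auto
  have pure: "pure3 a b c \<xi> \<eta> \<zeta> = \<xi> a * \<eta> b * \<zeta> c" for a b c
    using dual by (simp add: pure3_def)
  note bil = dual[THEN dual_bilinear_sum[OF circ_bilinear]] dual[THEN dual_bilinear_sum[OF ast_bilinear]]
  show "P_elem n x y \<xi> \<eta> \<zeta> =
      \<eta> (T \<xi> \<odot> S \<zeta>) - \<zeta> (T \<xi> \<odot> T \<eta>) + \<xi> (S \<eta> \<odot> S \<zeta>) - \<xi> (S \<zeta> \<odot> S \<eta>)"
    by (simp add: P_elem_def T S bil dual sum_tensor3_apply app pure sum.distrib sum_subtractf mult_ac)
  show "L_elem n x y \<xi> \<eta> \<zeta> =
      \<xi> (S \<eta> \<star> S \<zeta>) - \<eta> (T \<xi> \<star> S \<zeta>) - \<eta> (S \<zeta> \<star> T \<xi>) + \<zeta> (T \<eta> \<star> T \<xi>)"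
    by (simp add: L_elem_def T S bil dual sum_tensor3_apply app pure sum.distrib sum_subtractf mult_ac)
qed

lemma elem_outside_dual:
  assumes "\<xi> \<notin> dual \<or> \<eta> \<notin> dual \<or> \<zeta> \<notin> dual"
  shows "P_elem n x y \<xi> \<eta> \<zeta> = 0" "L_elem n x y \<xi> \<eta> \<zeta> = 0"
proof -
  have app: "(s + t) \<xi> \<eta> \<zeta> = s \<xi> \<eta> \<zeta> + t \<xi> \<eta> \<zeta>" "(s - t) \<xi> \<eta> \<zeta> = s \<xi> \<eta> \<zeta> - t \<xi> \<eta> \<zeta>"
    for s t :: "('a, 'k) tensor3"
    by auto
  have "pure3 a b c \<xi> \<eta> \<zeta> = 0" for a b c
    using assms by (auto simp: pure3_def)
  then show "P_elem n x y \<xi> \<eta> \<zeta> = 0" "L_elem n x y \<xi> \<eta> \<zeta> = 0"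
    by (simp_all add: P_elem_def L_elem_def sum_tensor3_apply app)
qed

end

section \<open>The DPYBE as the Rota-Baxter identity, and factorizability\<close>

context quadratic_tensor
begin

lemma sharp_r_omega: "sharp r (\<omega> b) = N b + b"
  by (rule sharp_eqI) (simp add: r_omega_left)

lemma sharp_flip_omega: "sharp (flip2 r) (\<omega> b) = N b"
  by (rule sharp_eqI) (simp add: r_omega_right flip2_def)

text \<open>On \<open>\<omega>\<close>-images the two elements are, up to sign and order of
  arguments, the form paired with the failure of the Rota-Baxter identity for each product.
  Nondegeneracy removes the form.\<close>

lemma DPYBE_iff_Rota_Baxter:
  "DPYBE r \<longleftrightarrow>
    (\<forall>b c. N b \<odot> N c = N (N b \<odot> c + b \<odot> N c + b \<odot> c)) \<and>
    (\<forall>b c. N b \<star> N c = N (N b \<star> c + b \<star> N c + b \<star> c))"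
proof -
  obtain n :: nat and x y where r: "r = (\<Sum>i<n. pure2 (x i) (y i))"
    using tensors2_explicit[OF r_tensors] by blast
  have P: "P_elem n x y (\<omega> b) (\<omega> c) (\<omega> d) =
      \<omega> (N b \<odot> N c - N (N b \<odot> c + b \<odot> N c + b \<odot> c)) d" for b c d
  proof -
    \<comment> \<open>\<open>omega_left_mult\<close> isolates a right factor; here the factor to
      isolate, \<open>N d\<close>, stands on the left. The same happens for the Leibniz product
      below.\<close>
    have "\<omega> b (N d \<odot> N c) = \<omega> (N c \<odot> b - b \<odot> N c) (N d)"
      using fun_cong[OF omega_comp(2), of b "N c" "N d"] by simp
    then show ?thesis
      using omega_skew[of d "(N b + b) \<odot> (N c + c)"]
      by (simp add: P_elem_apply[OF r omega_dual omega_dual omega_dual] sharp_r_omega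
        sharp_flip_omega omega_left_mult omega_N_right omega_simps omega_simps_left N_simps op_simps)
  qed
  have L: "L_elem n x y (\<omega> b) (\<omega> c) (\<omega> d) =
      - \<omega> (N c \<star> N b - N (N c \<star> b + c \<star> N b + c \<star> b)) d" for b c d
  proof -
    have "\<omega> c (N d \<star> (N b + b)) = \<omega> ((N b + b) \<star> c + c \<star> (N b + b)) (N d)"
      using fun_cong[OF omega_comp(6), of c "N b + b" "N d"] by simp
    then show ?thesis
      using omega_skew[of d "(N c + c) \<star> (N b + b)"]
      by (simp add: L_elem_apply[OF r omega_dual omega_dual omega_dual] sharp_r_omega
        sharp_flip_omega omega_left_mult omega_N_right omega_simps omega_simps_left N_simps op_simps)
  qed
  have zero_iff: "t = 0 \<longleftrightarrow> (\<forall>b c d. t (\<omega> b) (\<omega> c) (\<omega> d) = 0)"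
    if "\<And>\<xi> \<eta> \<zeta>. \<xi> \<notin> dual \<or> \<eta> \<notin> dual \<or> \<zeta> \<notin> dual \<Longrightarrow> t \<xi> \<eta> \<zeta> = 0" for t
    using tensor3_eqI[of t 0] that by auto
  have nondeg: "(\<forall>d. \<omega> (u - v) d = 0) \<longleftrightarrow> u = v" for u v
    using omega_nondegenerate[of "u - v"] by (auto simp: omega_simps_left)
  have "P_elem n x y = 0 \<longleftrightarrow> (\<forall>b c. N b \<odot> N c = N (N b \<odot> c + b \<odot> N c + b \<odot> c))"
    by (simp only: zero_iff[OF elem_outside_dual(1)] P nondeg)
  moreover have "L_elem n x y = 0 \<longleftrightarrow> (\<forall>b c. N b \<star> N c = N (N b \<star> c + b \<star> N c + b \<star> c))"
    \<comment> \<open>The identity appears with the roles of \<open>b\<close> and \<open>c\<close>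
      exchanged, which the last step repairs by renaming.\<close>
    by (simp only: zero_iff[OF elem_outside_dual(2)] L neg_equal_0_iff_equal nondeg) blast
  ultimately show ?thesis
    using DPYBE_iff[OF finite_dim r] by simp
qed

text \<open>\<open>N\<close> cancels in \<open>r - flip2 r\<close>, which corresponds to the
  identity operator. Its invariance thus only restates how the multiplications are transposed by the
  form.\<close>

lemma DP_invariant_skew_part: "DP_invariant (r - flip2 r)"
proof -
  define t where "t = r - flip2 r"
  have t: "t (\<omega> b) \<eta> = \<eta> b" if "\<eta> \<in> dual" for b \<eta>
    using that by (simp add: t_def r_omega_left r_omega_right flip2_def dual_simps)
  have "F a t = 0" "G a t = 0" for a
    by (rule tensor2_eqI; simp add: F_def G_def map2_def t omega_comp comp_dual omega_dual dual_simps)+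
  then show ?thesis by (simp add: DP_invariant_def t_def)
qed

lemma I_of_omega: "I_of r (\<omega> b) = b"
  by (simp add: I_of_def sharp_r_omega sharp_flip_omega)

lemma dual_iso_I_of: "dual_iso (I_of r)"
proof -
  have "bij_betw (I_of r) dual UNIV"
    by (rule bij_betw_byWitness[where f' = \<omega>])
      (auto simp: omega_dual I_of_omega dest!: omega_onto[OF finite_dim])
  then show ?thesis
    by (simp add: dual_iso_def I_of_def r_tensors tensors2_flip2 sharp_add sharp_scale
        scale_right_diff_distrib)
qed

lemma factorizable_if_Rota_Baxter:
  assumes "\<And>b c. N b \<odot> N c = N (N b \<odot> c + b \<odot> N c + b \<odot> c)"
    and "\<And>b c. N b \<star> N c = N (N b \<star> c + b \<star> N c + b \<star> c)"
  shows "factorizable r"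
proof -
  have "DPP_algebra scale descendent_circ descendent_ast"
    using descendent_DPP_algebra[OF N_linear assms] unfolding descendent_circ_def descendent_ast_def .
  then have "DPP_bialgebra scale circ ast (nu_of r) (theta_of r)"
    by (intro DPP_bialgebra_of_coalgebra DPP_coalgebra_of_descendent)
  moreover have "DPYBE r"
    unfolding DPYBE_iff_Rota_Baxter using assms by blast
  ultimately show ?thesis
    by (simp add: factorizable_def quasi_triangular_def r_tensors DP_invariant_skew_part dual_iso_I_of)
qed

end

section \<open>The two directions of the correspondence\<close>

context DPP_algebra
begin

text \<open>Since \<open>omega_of r\<close> inverts \<open>I_of r\<close>, the two sharp maps
  composed with it differ by the identity, which gives the shape \<open>N + id\<close> and
  \<open>N\<close>. Skewness of the form comes from antisymmetry of \<open>r - flip2 r\<close>, and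
  its invariance from the vanishing of \<open>F\<close> and \<open>G\<close> on that tensor.\<close>

lemma quadratic_of_invariant:
  assumes fd: "finite_dimensional_vector_space scale B"
    and r: "r \<in> tensors2" and iso: "dual_iso (I_of r)" and inv: "DP_invariant (r - flip2 r)"
  shows "quadratic_tensor scale circ ast (omega_of r) B r (\<lambda>a. sharp (flip2 r) (omega_of r a))"
proof -
  let ?\<omega> = "omega_of r"
  have bij: "bij_betw (I_of r) dual UNIV"
    and I_add: "\<And>\<xi> \<eta>. \<xi> \<in> dual \<Longrightarrow> \<eta> \<in> dual \<Longrightarrow> I_of r (\<xi> + \<eta>) = I_of r \<xi> + I_of r \<eta>"
    and I_scale: "\<And>c \<xi>. \<xi> \<in> dual \<Longrightarrow> I_of r (\<lambda>a. c * \<xi> a) = scale c (I_of r \<xi>)"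
    using iso by (simp_all add: dual_iso_def)
  have \<omega>_def: "?\<omega> a = the_inv_into dual (I_of r) a" for a
    by (simp add: omega_of_def fun_eq_iff)
  have \<omega>_dual: "?\<omega> a \<in> dual" and I_\<omega>: "I_of r (?\<omega> a) = a" for a
    using bij the_inv_into_into[of "I_of r" dual a dual] f_the_inv_into_f[of "I_of r" dual a]
    by (auto simp: \<omega>_def bij_betw_def)
  have \<omega>_I: "?\<omega> (I_of r \<xi>) = \<xi>" if "\<xi> \<in> dual" for \<xi>
    using bij that by (simp add: \<omega>_def bij_betw_def the_inv_into_f_f)
  have \<omega>_eqI: "?\<omega> a = \<xi>" if "\<xi> \<in> dual" "I_of r \<xi> = a" for a \<xi>
    using \<omega>_I[OF that(1)] that(2) by simp
  have flip: "flip2 r \<in> tensors2" using r by (rule tensors2_flip2)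
  define t where "t = r - flip2 r"
  \<comment> \<open>The two evaluations together say that \<open>I_of r\<close> is skew-adjoint. The
    second also exhibits linearity of \<open>t\<close> in its first slot.\<close>
  have t: "t \<xi> \<eta> = \<eta> (I_of r \<xi>)" "t \<xi> \<eta> = - \<xi> (I_of r \<eta>)" if "\<xi> \<in> dual" "\<eta> \<in> dual" for \<xi> \<eta>
  proof -
    have "flip2 r \<phi> \<psi> = r \<psi> \<phi>" for \<phi> \<psi>
      by (simp add: flip2_def)
    then show "t \<xi> \<eta> = \<eta> (I_of r \<xi>)" "t \<xi> \<eta> = - \<xi> (I_of r \<eta>)"
      using that by (simp_all add: t_def I_of_def dual_simps dual_sharp[OF r] dual_sharp[OF flip])
  qed
  have t_\<omega>: "t (?\<omega> a) \<eta> = \<eta> a" if "\<eta> \<in> dual" for a \<eta>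
    using t(1)[OF \<omega>_dual that] by (simp add: I_\<omega>)
  have linear: "?\<omega> (a + b) = ?\<omega> a + ?\<omega> b" "?\<omega> (scale c a) = (\<lambda>x. c * ?\<omega> a x)" for a b c
    by (rule \<omega>_eqI; simp add: add_dual scale_dual \<omega>_dual I_add I_scale I_\<omega>)+
  have inv': "F a t \<xi> \<eta> = 0" "G a t \<xi> \<eta> = 0" for a \<xi> \<eta>
    using inv by (simp_all add: DP_invariant_def t_def)
  have circ: "?\<omega> (b \<odot> a) = ?\<omega> b \<circ> ((\<lambda>x. a \<odot> x) - (\<lambda>x. x \<odot> a))" for a b
  proof (rule \<omega>_eqI)
    show d: "?\<omega> b \<circ> ((\<lambda>x. a \<odot> x) - (\<lambda>x. x \<odot> a)) \<in> dual"
      by (simp add: comp_dual \<omega>_dual)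
    show "I_of r (?\<omega> b \<circ> ((\<lambda>x. a \<odot> x) - (\<lambda>x. x \<odot> a))) = b \<odot> a"
    proof (rule dual_separates)
      fix \<eta> assume \<eta>: "\<eta> \<in> dual"
      \<comment> \<open>\<open>G\<close> contains \<open>Rc - L\<close>, whereas invariance of the
        form needs \<open>L - Rc\<close>; linearity in the first slot supplies the sign.\<close>
      have "?\<omega> b \<circ> ((\<lambda>x. x \<odot> a) - (\<lambda>x. a \<odot> x)) \<in> dual"
        by (simp add: comp_dual \<omega>_dual)
      then have "t (?\<omega> b \<circ> ((\<lambda>x. x \<odot> a) - (\<lambda>x. a \<odot> x))) \<eta> =
          - t (?\<omega> b \<circ> ((\<lambda>x. a \<odot> x) - (\<lambda>x. x \<odot> a))) \<eta>"
        using d \<eta> by (simp add: t(2) dual_simps \<omega>_dual)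
      then show "\<eta> (I_of r (?\<omega> b \<circ> ((\<lambda>x. a \<odot> x) - (\<lambda>x. x \<odot> a)))) = \<eta> (b \<odot> a)"
        using inv'(2)[of a "?\<omega> b" \<eta>] \<eta>
        by (simp add: G_def map2_def \<omega>_dual comp_dual t_\<omega> t(1)[OF d \<eta>, symmetric])
    qed
  qed
  have ast: "?\<omega> (b \<star> a) = ?\<omega> b \<circ> ((\<lambda>x. a \<star> x) + (\<lambda>x. x \<star> a))" for a b
  proof (rule \<omega>_eqI)
    show d: "?\<omega> b \<circ> ((\<lambda>x. a \<star> x) + (\<lambda>x. x \<star> a)) \<in> dual"
      by (simp add: comp_dual \<omega>_dual)
    show "I_of r (?\<omega> b \<circ> ((\<lambda>x. a \<star> x) + (\<lambda>x. x \<star> a))) = b \<star> a"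
    proof (rule dual_separates)
      fix \<eta> assume \<eta>: "\<eta> \<in> dual"
      show "\<eta> (I_of r (?\<omega> b \<circ> ((\<lambda>x. a \<star> x) + (\<lambda>x. x \<star> a)))) = \<eta> (b \<star> a)"
        using inv'(1)[of a "?\<omega> b" \<eta>] t(1)[OF d \<eta>] \<eta>
        by (simp add: F_def map2_def \<omega>_dual comp_dual t_\<omega>)
    qed
  qed
  have skew: "?\<omega> a b = - ?\<omega> b a" for a b
    using t[OF \<omega>_dual \<omega>_dual, of b a] by (simp add: I_\<omega>)
  have sharp_r: "sharp r (?\<omega> b) = sharp (flip2 r) (?\<omega> b) + b" for b
    using I_\<omega>[of b] by (simp add: I_of_def algebra_simps)
  have "quadratic_DPP_algebra scale circ ast ?\<omega>"
  proof
    have mult_vs: "vector_space ((*) :: 'k \<Rightarrow> 'k \<Rightarrow> 'k)"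
      by unfold_locales (auto simp: algebra_simps)
    show "bilinear_form ?\<omega>"
      unfolding bilinear_form_def using \<omega>_dual
      by (auto simp: dual_def Vector_Spaces.linear_iff vector_space_axioms mult_vs linear)
    show "?\<omega> a1 a2 = - ?\<omega> a2 a1" for a1 a2 by (rule skew)
    show "a1 = 0" if "\<And>a2. ?\<omega> a1 a2 = 0" for a1
    proof -
      have "?\<omega> a1 = ?\<omega> 0"
        using that linear(1)[of 0 0] by (auto simp: fun_eq_iff)
      then show ?thesis using I_\<omega>[of a1] I_\<omega>[of 0] by simp
    qed
    show "?\<omega> (a1 \<odot> a2) a3 = ?\<omega> a1 (a2 \<odot> a3 - a3 \<odot> a2)" for a1 a2 a3 by (simp add: circ)
    show "?\<omega> (a1 \<star> a2) a3 = ?\<omega> a1 (a2 \<star> a3 + a3 \<star> a2)" for a1 a2 a3 by (simp add: ast)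
  qed
  then show ?thesis
  proof (intro quadratic_tensor.intro quadratic_tensor_axioms.intro fd r)
    show "Vector_Spaces.linear scale scale (\<lambda>a. sharp (flip2 r) (?\<omega> a))"
      by (simp add: Vector_Spaces.linear_iff vector_space_axioms linear sharp_add[OF flip]
          sharp_scale[OF flip] \<omega>_dual)
    show "r (?\<omega> b) \<eta> = \<eta> (sharp (flip2 r) (?\<omega> b) + b)" if "\<eta> \<in> dual" for b \<eta>
      using dual_sharp[OF r \<omega>_dual that] by (simp add: sharp_r)
    show "r \<eta> (?\<omega> b) = \<eta> (sharp (flip2 r) (?\<omega> b))" if "\<eta> \<in> dual" for b \<eta>
      using dual_sharp[OF flip \<omega>_dual that] by (simp add: flip2_def)
  qed
qed

text \<open>\<open>R_of lam r\<close> is \<open>lam\<close> times the operator \<open>?N\<close>,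
  and multiplying by \<open>lam\<close> turns the weight 1 identities into those of weight
  \<open>lam\<close>.\<close>

lemma factorizable_imp_quadratic_Rota_Baxter:
  assumes fd: "finite_dimensional_vector_space scale B" and r: "factorizable r"
  shows "quadratic_RB_DPP_algebra scale circ ast (omega_of r) (R_of lam r) lam"
proof -
  let ?N = "\<lambda>a. sharp (flip2 r) (omega_of r a)"
  interpret Q: quadratic_tensor scale circ ast "omega_of r" B r ?N
    using r by (intro quadratic_of_invariant[OF fd]) (auto simp: factorizable_def quasi_triangular_def)
  have "omega_of r = the_inv_into dual (I_of r)"
    by (simp add: omega_of_def fun_eq_iff)
  then have R: "R_of lam r = (\<lambda>a. scale lam (?N a))"
    by (intro ext) (simp add: R_of_def)
  have RB: "?N a \<odot> ?N b = ?N (?N a \<odot> b + a \<odot> ?N b + a \<odot> b)"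
      "?N a \<star> ?N b = ?N (?N a \<star> b + a \<star> ?N b + a \<star> b)" for a b
    using r Q.DPYBE_iff_Rota_Baxter unfolding factorizable_def quasi_triangular_def by blast+
  show ?thesis
    unfolding R
  proof (intro quadratic_RB_DPP_algebra.intro quadratic_RB_DPP_algebra_axioms.intro
      Q.quadratic_DPP_algebra_axioms)
    show "Vector_Spaces.linear scale scale (\<lambda>a. scale lam (?N a))"
      by (simp add: Vector_Spaces.linear_iff vector_space_axioms Q.N_simps scale_right_distrib
          mult.commute)
    show "scale lam (?N a1) \<odot> scale lam (?N a2) =
        scale lam (?N (scale lam (?N a1) \<odot> a2 + a1 \<odot> scale lam (?N a2) + scale lam (a1 \<odot> a2)))" for a1 a2
      by (simp only: op_simps RB scale_right_distrib[symmetric] Q.N_simps(2))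
    show "scale lam (?N a1) \<star> scale lam (?N a2) =
        scale lam (?N (scale lam (?N a1) \<star> a2 + a1 \<star> scale lam (?N a2) + scale lam (a1 \<star> a2)))" for a1 a2
      by (simp only: op_simps RB scale_right_distrib[symmetric] Q.N_simps(2))
    show "omega_of r a1 (scale lam (?N a2)) + omega_of r (scale lam (?N a1)) a2 +
        lam * omega_of r a1 a2 = 0" for a1 a2
      using Q.omega_N[of a1 a2] by (simp add: Q.omega_simps distrib_left[symmetric])
  qed
qed

text \<open>Dividing \<open>R\<close> by \<open>lam\<close> gives an operator \<open>N\<close> of
  weight 1 for which the sharp map of \<open>r\<close> is \<open>N + id\<close> after
  \<open>J_of \<omega>\<close>. The weight 1 criterion for factorizability then applies.\<close>

lemma quadratic_Rota_Baxter_imp_factorizable: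
  assumes fd: "finite_dimensional_vector_space scale B"
    and quad: "quadratic_RB_DPP_algebra scale circ ast \<omega> R lam" and lam: "lam \<noteq> 0"
  defines "r \<equiv> r_of lam \<omega> R"
  shows "factorizable r"
proof -
  interpret Q: quadratic_RB_DPP_algebra scale circ ast \<omega> R lam by (rule quad)
  define N where "N a = scale (1 / lam) (R a)" for a
  have R_lin: "R (x + y) = R x + R y" "R (scale c x) = scale c (R x)" for x y c
    using Q.R_linear by (simp_all add: Vector_Spaces.linear_iff)
  have R: "R a = scale lam (N a)" for a
    using lam by (simp add: N_def)
  have "inj \<omega>"
    by (rule injI) (rule Q.omega_inj)
  then have J: "J_of \<omega> (\<omega> b) = b" for b
    by (simp add: J_of_def the_inv_into_f_f)
  have \<omega>_add: "\<omega> a + \<omega> b = \<omega> (a + b)" and \<omega>_scale: "(\<lambda>x. c * \<omega> a x) = \<omega> (scale c a)" for a b c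
    by (simp_all add: fun_eq_iff Q.omega_simps)
  note onto = Q.omega_onto[OF fd]
  have r: "r = tensor_of (\<lambda>\<xi>. N (J_of \<omega> \<xi>) + J_of \<omega> \<xi>)"
    using lam by (simp add: r_def r_of_def N_def scale_right_distrib)
  have r_left: "r (\<omega> b) \<eta> = \<eta> (N b + b)" if "\<eta> \<in> dual" for b \<eta>
    using that by (simp add: r tensor_of_def J Q.omega_dual)
  interpret T: quadratic_tensor scale circ ast \<omega> B r N
  proof (intro quadratic_tensor.intro quadratic_tensor_axioms.intro fd
      Q.quadratic_DPP_algebra_axioms)
    show "r \<in> tensors2"
      unfolding r
      by (rule tensor_of_in_tensors2[OF fd])
        (auto dest!: onto simp: \<omega>_add \<omega>_scale J N_def R_lin scale_right_distrib mult.commute)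
    show "Vector_Spaces.linear scale scale N"
      by (simp add: Vector_Spaces.linear_iff vector_space_axioms N_def R_lin scale_right_distrib
          mult.commute)
    show "r (\<omega> b) \<eta> = \<eta> (N b + b)" if "\<eta> \<in> dual" for b \<eta>
      using that by (rule r_left)
    \<comment> \<open>The left rule holds by construction of \<open>r\<close>. The right rule is
      where compatibility of \<open>R\<close> with the form enters: it says that the flipped tensor
      gives \<open>N\<close>.\<close>
    show "r \<eta> (\<omega> b) = \<eta> (N b)" if "\<eta> \<in> dual" for b \<eta>
    proof -
      obtain c where \<eta>: "\<eta> = \<omega> c" using onto \<open>\<eta> \<in> dual\<close> by blast
      have "lam * (\<omega> c (N b) + \<omega> (N c) b + \<omega> c b) = 0"
        using Q.R_omega[of c b] by (simp add: R Q.omega_simps distrib_left)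
      then have "\<omega> c (N b) + \<omega> (N c) b + \<omega> c b = 0"
        using lam by simp
      then have "\<omega> c (N b) = - \<omega> (N c) b - \<omega> c b"
        by (simp add: algebra_simps eq_neg_iff_add_eq_0)
      then show ?thesis
        using Q.omega_skew[of b "N c"] Q.omega_skew[of b c]
        by (simp add: \<eta> r_left Q.omega_dual Q.omega_simps)
    qed
  qed
  have RB: "N a \<odot> N b = N (N a \<odot> b + a \<odot> N b + a \<odot> b)" for a b
  proof -
    \<comment> \<open>The identity is proved after multiplication by the square of
      \<open>lam\<close>, which is then cancelled.\<close>
    have "scale (lam * lam) (N a \<odot> N b) = R a \<odot> R b"
      by (simp add: R op_simps)
    also have "\<dots> = R (scale lam (N a \<odot> b + a \<odot> N b + a \<odot> b))"
      unfolding Q.R_circ by (simp add: R op_simps scale_right_distrib)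
    also have "\<dots> = scale (lam * lam) (N (N a \<odot> b + a \<odot> N b + a \<odot> b))"
      unfolding R_lin(2) by (simp add: R)
    finally show ?thesis using lam by simp
  qed
  have RB': "N a \<star> N b = N (N a \<star> b + a \<star> N b + a \<star> b)" for a b
  proof -
    have "scale (lam * lam) (N a \<star> N b) = R a \<star> R b"
      by (simp add: R op_simps)
    also have "\<dots> = R (scale lam (N a \<star> b + a \<star> N b + a \<star> b))"
      unfolding Q.R_ast by (simp add: R op_simps scale_right_distrib)
    also have "\<dots> = scale (lam * lam) (N (N a \<star> b + a \<star> N b + a \<star> b))"
      unfolding R_lin(2) by (simp add: R)
    finally show ?thesis using lam by simp
  qed
  show ?thesis
    by (rule T.factorizable_if_Rota_Baxter[OF RB RB'])
qed

end

theorem theorem3p8: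
  fixes scale :: "'k::field_char_0 \<Rightarrow> 'a::ab_group_add \<Rightarrow> 'a"
    and Basis :: "'a set"
    and circ ast :: "'a \<Rightarrow> 'a \<Rightarrow> 'a"
    and lam :: 'k
  assumes "finite_dimensional_vector_space scale Basis"
    and "DPP_algebra scale circ ast"
  shows
    "(\<forall>r \<in> tensor_space.tensors2 scale.
        DPP_algebra.factorizable scale circ ast r \<longrightarrow>
        quadratic_RB_DPP_algebra scale circ ast
          (tensor_space.omega_of scale r) (tensor_space.R_of scale lam r) lam) \<and>
     (\<forall>\<omega> R.
        quadratic_RB_DPP_algebra scale circ ast \<omega> R lam \<longrightarrow> lam \<noteq> 0 \<longrightarrow>
        (let r = tensor_space.r_of scale lam \<omega> R in
          r \<in> tensor_space.tensors2 scale \<and>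
          DPP_algebra.DPYBE scale circ ast r \<and>
          DPP_algebra.factorizable scale circ ast r))"
proof -
  interpret DPP_algebra scale circ ast by (rule assms(2))
  show ?thesis
    using factorizable_imp_quadratic_Rota_Baxter[OF assms(1)]
      quadratic_Rota_Baxter_imp_factorizable[OF assms(1)]
    by (auto simp: Let_def factorizable_def quasi_triangular_def)
qed

end
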